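(* Let $N$ and $M$ be positive integers, $\Omega=\{-1,+1\}^N$, $\hat J\in[0,+\infty)$, let $\mu_N$ be the Gibbs measure of the one-dimensional periodic Ising model with coupling constant $\hat J$, and let $(Y_k)_{k\ge1}$ be the Wolff dynamics on $\Omega$ with coupling constant $\hat J$ and transition kernel $P_{\mathrm W}$. Then for any function $f:\Omega\to\mathbb R$, $$\left\|\frac1M\sum_{k=1}^M P_{\mathrm W}^kf-E_{\mu_N}[f]\right\|_{L^2(\mu_N)}\le\frac{\|f\|_{L^2(\mu_N)}}{M}\bigg(2+\frac{e^{2\hat J}(e^{4\hat J}+1)}{2}\Big(\frac12+\hat Je^{\frac{e^{2\hat J}-1}{2}}\Big)N\bigg),$$ where $P_{\mathrm W}^kf(x)=\sum_{y\in\Omega}f(y)P_{\mathrm W}^k(x,y)$ for $x\in\Omega$, $1\le k\le M$. Moreover, $$E^{\mathbb P_{\mu_N}}\left[\left(\frac1M\sum_{k=1}^Mf(Y_k)-E_{\mu_N}[f]\right)^2\right]\le\frac{\|f\|_{L^2(\mu_N)}^2}{M}e^{2\hat J}(e^{4\hat J}+1)\Big(\frac12+\hat Je^{\frac{e^{2\hat J}-1}{2}}\Big)N,$$ where $\mathbb P_{\mu_N}$ denotes the law of the chain started from $Y_1\sim\mu_N$.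
   Context: Indices in $[N]=\{1,\dots,N\}$ are cyclic ($N+1\equiv1$). The Gibbs measure is $\mu_N(\sigma)=Z_N^{-1}\exp\big(\hat J\sum_{i=1}^N\sigma_i\sigma_{i+1}\big)$ on $\Omega$, with $Z_N$ the normalizing constant; $E_{\mu_N}$ is expectation with respect to $\mu_N$, and $\|f\|_{L^2(\mu_N)}^2=E_{\mu_N}[f^2]$. $E^{\mathbb P_{\mu_N}}$ is expectation under $\mathbb P_{\mu_N}$. $P_{\mathrm W}^k$ is the $k$-step transition kernel. $G=([N],\mathcal G)$ is the undirected cycle with the $N$ edges $\{i,i+1\}$, $i=1,\dots,N$ (counted with multiplicity if $N=2$). Wolff dynamics: one step from $\sigma\in\Omega$ is as follows. Choose a site $i_0\in[N]$ uniformly at random and start the cluster with $i_0$. Repeatedly, for each site $i$ in the cluster and each edge joining $i$ to a neighbour $j$ with $\sigma_j=\sigma_i$ such that this edge has not been considered before, add $j$ to the cluster with probability $1-e^{-\hat J(1+\sigma_i\sigma_j)}=1-e^{-2\hat J}$, independently over edges. When no edge remains to be considered, flip all spins of the cluster (with probability 1). Equivalently: declare each edge with aligned endpoint spins open independently with probability $1-e^{-2\hat J}$ (all other edges are closed), and flip the open-connected component of $i_0$. $P_{\mathrm W}(\sigma,\eta)$ is the probability that one step from $\sigma$ produces $\eta$. *)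

theory Defs
  imports "HOL-Probability.Probability"
begin

definition spin_space :: "nat \<Rightarrow> (nat \<Rightarrow> int) set" where
  "spin_space N = PiE {1..N} (\<lambda>_. {-1, 1})"

definition cyc_succ :: "nat \<Rightarrow> nat \<Rightarrow> nat" where
  "cyc_succ N i = (if i = N then 1 else i + 1)"

subsection \<open>Gibbs measure\<close>

definition gibbs_weight :: "nat \<Rightarrow> real \<Rightarrow> (nat \<Rightarrow> int) \<Rightarrow> real" where
  "gibbs_weight N J \<sigma> = exp (J * (\<Sum>i=1..N. real_of_int (\<sigma> i * \<sigma> (cyc_succ N i))))"

definition partition_function :: "nat \<Rightarrow> real \<Rightarrow> real" where
  "partition_function N J = (\<Sum>\<sigma>\<in>spin_space N. gibbs_weight N J \<sigma>)"

definition gibbs :: "nat \<Rightarrow> real \<Rightarrow> (nat \<Rightarrow> int) \<Rightarrow> real" where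
  "gibbs N J \<sigma> = gibbs_weight N J \<sigma> / partition_function N J"

definition gibbs_expectation :: "nat \<Rightarrow> real \<Rightarrow> ((nat \<Rightarrow> int) \<Rightarrow> real) \<Rightarrow> real" where
  "gibbs_expectation N J f = (\<Sum>\<sigma>\<in>spin_space N. f \<sigma> * gibbs N J \<sigma>)"

definition gibbs_L2_norm :: "nat \<Rightarrow> real \<Rightarrow> ((nat \<Rightarrow> int) \<Rightarrow> real) \<Rightarrow> real" where
  "gibbs_L2_norm N J f = sqrt (gibbs_expectation N J (\<lambda>\<sigma>. (f \<sigma>)\<^sup>2))"

subsection \<open>Wolff dynamics\<close>

text \<open>
  The edges of the cycle are labelled by their first endpoint: edge \<open>e \<in> {1..N}\<close> joins
  \<open>e\<close> and \<open>cyc_succ N e\<close>. So for \<open>N = 2\<close> there are two parallel edges, and for \<open>N = 1\<close> a loop.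
\<close>

definition aligned_edges :: "nat \<Rightarrow> (nat \<Rightarrow> int) \<Rightarrow> nat set" where
  "aligned_edges N \<sigma> = {e \<in> {1..N}. \<sigma> e = \<sigma> (cyc_succ N e)}"

definition open_cluster :: "nat \<Rightarrow> nat set \<Rightarrow> nat \<Rightarrow> nat set" where
  "open_cluster N E i =
     {j. (i, j) \<in> ((\<lambda>e. (e, cyc_succ N e)) ` E \<union> (\<lambda>e. (cyc_succ N e, e)) ` E)\<^sup>*}"

definition flip_spins :: "nat set \<Rightarrow> (nat \<Rightarrow> int) \<Rightarrow> nat \<Rightarrow> int" where
  "flip_spins C \<sigma> = (\<lambda>i. if i \<in> C then - \<sigma> i else \<sigma> i)"

text \<open>
  One step of the dynamics. The function \<open>b\<close> tells which edges are open; edges that are not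
  aligned get the default value \<open>False\<close>, that is, they are closed.
\<close>

definition wolff_step :: "nat \<Rightarrow> real \<Rightarrow> (nat \<Rightarrow> int) \<Rightarrow> (nat \<Rightarrow> int) pmf" where
  "wolff_step N J \<sigma> =
     bind_pmf (pmf_of_set {1..N}) (\<lambda>i\<^sub>0.
     bind_pmf (Pi_pmf (aligned_edges N \<sigma>) False (\<lambda>_. bernoulli_pmf (1 - exp (- 2 * J)))) (\<lambda>b.
     return_pmf (flip_spins (open_cluster N {e. b e} i\<^sub>0) \<sigma>)))"

definition wolff_kernel :: "nat \<Rightarrow> real \<Rightarrow> (nat \<Rightarrow> int) \<Rightarrow> (nat \<Rightarrow> int) \<Rightarrow> real" where
  "wolff_kernel N J \<sigma> \<eta> = pmf (wolff_step N J \<sigma>) \<eta>"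

subsection \<open>Markov chains on a finite state space\<close>

primrec kernel_power :: "'s set \<Rightarrow> ('s \<Rightarrow> 's \<Rightarrow> real) \<Rightarrow> nat \<Rightarrow> 's \<Rightarrow> 's \<Rightarrow> real" where
  "kernel_power \<Omega> P 0 x y = (if x = y then 1 else 0)"
| "kernel_power \<Omega> P (Suc k) x y = (\<Sum>z\<in>\<Omega>. P x z * kernel_power \<Omega> P k z y)"

definition kernel_apply ::
    "'s set \<Rightarrow> ('s \<Rightarrow> 's \<Rightarrow> real) \<Rightarrow> nat \<Rightarrow> ('s \<Rightarrow> real) \<Rightarrow> 's \<Rightarrow> real" where
  "kernel_apply \<Omega> P k f x = (\<Sum>y\<in>\<Omega>. f y * kernel_power \<Omega> P k x y)"

text \<open>
  \<open>Y 1, Y 2, \<dots>\<close> is a Markov chain under the probability measure \<open>S\<close>, with initial distribution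
  \<open>\<mu>\<close> and transition kernel \<open>P\<close>; \<open>Y 0\<close> is irrelevant. The Markov property is multiplied out, so
  that no conditioning on a null event occurs.
\<close>

definition markov_chain ::
    "'w measure \<Rightarrow> (nat \<Rightarrow> 'w \<Rightarrow> 's) \<Rightarrow> 's set \<Rightarrow> ('s \<Rightarrow> real) \<Rightarrow> ('s \<Rightarrow> 's \<Rightarrow> real) \<Rightarrow> bool" where
  "markov_chain S Y \<Omega> \<mu> P \<longleftrightarrow>
     prob_space S \<and>
     (\<forall>k\<ge>1. Y k \<in> measurable S (count_space \<Omega>)) \<and>
     (\<forall>x\<in>\<Omega>. measure S {w \<in> space S. Y 1 w = x} = \<mu> x) \<and>
     (\<forall>n\<ge>1. \<forall>x. (\<forall>k\<in>{1..Suc n}. x k \<in> \<Omega>) \<longrightarrow>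
        measure S {w \<in> space S. \<forall>k\<in>{1..Suc n}. Y k w = x k} =
        measure S {w \<in> space S. \<forall>k\<in>{1..n}. Y k w = x k} * P (x n) (x (Suc n)))"

end

theory Submission imports Defs begin

text \<open>
  The Wolff dynamics is reversible with respect to the Gibbs measure, and both inequalities follow
  from a lower bound for its spectral gap on functions of mean zero.

  Suppose that \<open>Var g \<le> C * dirichlet g\<close> for all \<open>g\<close>. Then every eigenvalue of the kernel on
  mean-zero functions lies in \<open>[- 1, 1 - 1 / C]\<close>. The error of the averaged iterates is governed by
  the polynomial \<open>\<kappa> + \<dots> + \<kappa> ^ M\<close> at these eigenvalues, which is bounded by \<open>1 + C\<close>. The mean square
  error of the time average of the stationary chain is governed by the double sum of
  \<open>\<kappa> ^ \<bar>k - l\<bar>\<close>, which is bounded by \<open>2 * C * M\<close> if \<open>C \<ge> 1 / 2\<close>. Negative eigenvalues close to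
  \<open>- 1\<close> do no harm, since the powers cancel. These are \<open>ergodic_average_L2_le\<close> and
  \<open>stationary_mean_square_error_le\<close>. The passage from operators to eigenvalues
  (\<open>polynomial_form_le\<close>) relies only on the fact that the maximum of a quadratic form on the unit
  sphere is attained at an eigenvector (\<open>rayleigh_maximiser_is_eigenvector\<close>).

  The gap comes from a comparison with the heat bath, which resamples one spin given all others. In the
  one-dimensional Ising model a spin feels each of its two neighbours with strength
  \<open>tanh (2 * J) / 2\<close>. So the total influence \<open>tanh (2 * J)\<close> is below \<open>1\<close> for every \<open>J\<close>, and
  Dobrushin's contraction argument (\<open>dobrushin_spectral_gap\<close>) gives the gap
  \<open>1 - tanh (2 * J) = 2 / (exp (4 * J) + 1)\<close> for the heat bath in which each site has rate \<open>1\<close>. A Wolff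
  step flips only the site \<open>i\<close> if it starts there and the aligned edges at \<open>i\<close> are closed. The
  probability of this is at least \<open>2 * exp (- 2 * J) / N\<close> times the heat-bath flip rate at \<open>i\<close>
  (\<open>wolff_rate_ge_heat_bath_rate\<close>). Together this yields
  \<open>C = N * exp (2 * J) * (exp (4 * J) + 1) / 4\<close> (\<open>wolff_spectral_gap\<close>).

  Reversibility (\<open>wolff_detailed_balance\<close>) holds because the joint weight of the spins and the open
  edges does not depend on the spins, as long as all open edges are aligned.
\<close>

section \<open>Quadratic forms of symmetric kernels\<close>

text \<open>
  The inner product of \<open>L\<^sup>2(\<mu>)\<close>, written as a finite weighted sum.
\<close>

definition wip :: "'s set \<Rightarrow> ('s \<Rightarrow> real) \<Rightarrow> ('s \<Rightarrow> real) \<Rightarrow> ('s \<Rightarrow> real) \<Rightarrow> real" where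
  "wip \<Omega> \<mu> f g = (\<Sum>x\<in>\<Omega>. \<mu> x * f x * g x)"

text \<open>
  Functions on \<open>\<Omega>\<close> are represented by functions on the whole type that vanish outside
  \<open>\<Omega>\<close>, and operators return such functions. Then an eigenvector equation is an equality of
  functions, and a bounded set of such functions is compact in the product topology.
\<close>

definition kernel_op :: "'s set \<Rightarrow> ('s \<Rightarrow> 's \<Rightarrow> real) \<Rightarrow> ('s \<Rightarrow> real) \<Rightarrow> 's \<Rightarrow> real" where
  "kernel_op \<Omega> K f x = (if x \<in> \<Omega> then \<Sum>y\<in>\<Omega>. K x y * f y else 0)"

definition closed_subspace_on :: "'s set \<Rightarrow> ('s \<Rightarrow> real) set \<Rightarrow> bool" where
  "closed_subspace_on \<Omega> V \<longleftrightarrow> closed V \<and> (\<forall>g\<in>V. \<forall>x. x \<notin> \<Omega> \<longrightarrow> g x = 0) \<and>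
     (\<lambda>_. 0) \<in> V \<and> (\<forall>g\<in>V. \<forall>h\<in>V. \<forall>a b. (\<lambda>x. a * g x + b * h x) \<in> V)"

lemma continuous_on_kernel_op [continuous_intros]:
  "continuous_on S (\<lambda>g. kernel_op \<Omega> K g x)"
  unfolding kernel_op_def
  by (cases "x \<in> \<Omega>")
    (auto intro!: continuous_intros continuous_on_subset[OF continuous_on_product_coordinates])

locale weighted_space =
  fixes \<Omega> :: "'s set" and \<mu> :: "'s \<Rightarrow> real"
  assumes finite_states: "finite \<Omega>" and weight_pos: "x \<in> \<Omega> \<Longrightarrow> \<mu> x > 0"
begin

lemma wip_commute: "wip \<Omega> \<mu> f g = wip \<Omega> \<mu> g f"
  unfolding wip_def by (simp add: mult_ac)

lemma wip_lin_left:
  "wip \<Omega> \<mu> (\<lambda>x. a * f x + b * g x) h = a * wip \<Omega> \<mu> f h + b * wip \<Omega> \<mu> g h"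
  unfolding wip_def by (simp add: algebra_simps sum.distrib sum_distrib_left)

lemma wip_lin_right:
  "wip \<Omega> \<mu> h (\<lambda>x. a * f x + b * g x) = a * wip \<Omega> \<mu> h f + b * wip \<Omega> \<mu> h g"
  by (simp add: wip_commute[of h] wip_lin_left)

lemma wip_scale_left: "wip \<Omega> \<mu> (\<lambda>x. a * f x) h = a * wip \<Omega> \<mu> f h"
  using wip_lin_left[of a f 0 f h] by simp

lemma wip_scale_right: "wip \<Omega> \<mu> h (\<lambda>x. a * f x) = a * wip \<Omega> \<mu> h f"
  by (simp add: wip_commute[of h] wip_scale_left)

lemma wip_self_nonneg: "wip \<Omega> \<mu> f f \<ge> 0"
  unfolding wip_def by (intro sum_nonneg) (simp add: weight_pos less_imp_le mult.assoc)

lemma wip_self_eq_0: "wip \<Omega> \<mu> f f = 0 \<longleftrightarrow> (\<forall>x\<in>\<Omega>. f x = 0)"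
proof -
  have "wip \<Omega> \<mu> f f = 0 \<longleftrightarrow> (\<forall>x\<in>\<Omega>. \<mu> x * f x * f x = 0)"
    unfolding wip_def
    by (intro sum_nonneg_eq_0_iff finite_states) (simp add: weight_pos less_imp_le mult.assoc)
  also have "\<dots> \<longleftrightarrow> (\<forall>x\<in>\<Omega>. f x = 0)" using weight_pos by fastforce
  finally show ?thesis .
qed

lemma continuous_on_wip [continuous_intros]:
  assumes "\<And>x. continuous_on S (\<lambda>g. F g x)" "\<And>x. continuous_on S (\<lambda>g. G g x)"
  shows "continuous_on S (\<lambda>g. wip \<Omega> \<mu> (F g) (G g))"
  unfolding wip_def by (intro continuous_intros assms)

lemma kernel_op_lin:
  "kernel_op \<Omega> K (\<lambda>x. a * f x + b * g x) = (\<lambda>x. a * kernel_op \<Omega> K f x + b * kernel_op \<Omega> K g x)"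
  unfolding kernel_op_def by (auto simp: algebra_simps sum.distrib sum_distrib_left)

lemma kernel_op_selfadjoint:
  assumes "\<And>x y. x \<in> \<Omega> \<Longrightarrow> y \<in> \<Omega> \<Longrightarrow> \<mu> x * K x y = \<mu> y * K y x"
  shows "wip \<Omega> \<mu> (kernel_op \<Omega> K f) g = wip \<Omega> \<mu> f (kernel_op \<Omega> K g)"
proof -
  have "wip \<Omega> \<mu> (kernel_op \<Omega> K f) g = (\<Sum>x\<in>\<Omega>. \<Sum>y\<in>\<Omega>. \<mu> x * K x y * f y * g x)"
    unfolding wip_def kernel_op_def
    by (auto simp: sum_distrib_left sum_distrib_right mult_ac intro!: sum.cong)
  also have "\<dots> = (\<Sum>y\<in>\<Omega>. \<Sum>x\<in>\<Omega>. \<mu> x * K x y * f y * g x)" by (rule sum.swap)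
  also have "\<dots> = wip \<Omega> \<mu> f (kernel_op \<Omega> K g)"
    unfolding wip_def kernel_op_def
    by (auto simp: sum_distrib_left sum_distrib_right mult_ac assms intro!: sum.cong)
  finally show ?thesis .
qed

text \<open>
  A function of norm \<open>1\<close> satisfies \<open>\<bar>g x\<bar> \<le> 1 / sqrt (\<mu> x)\<close> and vanishes outside \<open>\<Omega>\<close>, so
  the unit sphere lies in a product of compact intervals.
\<close>

lemma compact_unit_sphere:
  assumes "closed_subspace_on \<Omega> V"
  shows "compact {g \<in> V. wip \<Omega> \<mu> g g = 1}"
proof -
  define B where "B x = (if x \<in> \<Omega> then {- sqrt (1 / \<mu> x) .. sqrt (1 / \<mu> x)} else {0})" for x
  have "compactin (product_topology (\<lambda>_. euclidean) UNIV) (PiE UNIV B)"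
    by (subst compactin_PiE) (auto simp: B_def)
  hence comp: "compact (PiE UNIV B)"
    by (simp add: euclidean_product_topology)
  have clo: "closed {g \<in> V. wip \<Omega> \<mu> g g = 1}"
  proof -
    have "{g \<in> V. wip \<Omega> \<mu> g g = 1} = V \<inter> {g. wip \<Omega> \<mu> g g = 1}" by auto
    moreover have "closed {g. wip \<Omega> \<mu> g g = 1}"
      by (intro closed_Collect_eq continuous_intros continuous_on_product_coordinates)
    ultimately show ?thesis using assms by (auto simp: closed_subspace_on_def)
  qed
  have "{g \<in> V. wip \<Omega> \<mu> g g = 1} \<subseteq> PiE UNIV B"
  proof
    fix g assume "g \<in> {g \<in> V. wip \<Omega> \<mu> g g = 1}"
    hence g: "g \<in> V" "wip \<Omega> \<mu> g g = 1" by auto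
    have "g x \<in> B x" for x
    proof (cases "x \<in> \<Omega>")
      case True
      have "\<mu> x * g x * g x \<le> wip \<Omega> \<mu> g g" unfolding wip_def
        by (rule member_le_sum[OF True _ finite_states]) (simp add: weight_pos less_imp_le mult.assoc)
      hence "(g x)\<^sup>2 \<le> 1 / \<mu> x"
        using g weight_pos[OF True] by (simp add: field_simps power2_eq_square)
      hence "\<bar>g x\<bar> \<le> sqrt (1 / \<mu> x)" by (intro real_le_rsqrt) simp
      thus ?thesis using True by (simp add: B_def abs_le_iff)
    next
      case False
      thus ?thesis using g assms by (auto simp: closed_subspace_on_def B_def)
    qed
    thus "g \<in> PiE UNIV B" by (intro PiE_I) auto
  qed
  hence "PiE UNIV B \<inter> {g \<in> V. wip \<Omega> \<mu> g g = 1} = {g \<in> V. wip \<Omega> \<mu> g g = 1}"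
    by (rule inf_absorb2)
  thus ?thesis using compact_Int_closed[OF comp clo] by (simp only:)
qed

text \<open>
  The part of the spectral theorem that is used below: on the compact unit sphere the quadratic
  form \<open>\<langle>g, A g\<rangle>\<close> of a symmetric kernel has a maximiser \<open>h\<close>, and by the first order condition
  \<open>\<theta> h - A h\<close> is orthogonal to the invariant subspace that contains it.
\<close>

lemma rayleigh_maximiser_is_eigenvector:
  assumes V: "closed_subspace_on \<Omega> V" and nontriv: "u \<in> V" "u \<noteq> (\<lambda>_. 0)"
    and sym: "\<And>x y. x \<in> \<Omega> \<Longrightarrow> y \<in> \<Omega> \<Longrightarrow> \<mu> x * K x y = \<mu> y * K y x"
    and inv: "\<And>g. g \<in> V \<Longrightarrow> kernel_op \<Omega> K g \<in> V"
  obtains h \<theta> where "h \<in> V" "h \<noteq> (\<lambda>_. 0)" "kernel_op \<Omega> K h = (\<lambda>x. \<theta> * h x)"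
    "\<And>g. g \<in> V \<Longrightarrow> wip \<Omega> \<mu> g (kernel_op \<Omega> K g) \<le> \<theta> * wip \<Omega> \<mu> g g"
proof -
  let ?A = "kernel_op \<Omega> K" and ?i = "wip \<Omega> \<mu>"
  let ?S = "{g \<in> V. ?i g g = 1}"
  have lin: "(\<lambda>x. a * g x + b * h x) \<in> V" if "g \<in> V" "h \<in> V" for g h a b
    using V that by (auto simp: closed_subspace_on_def)
  have scale: "(\<lambda>x. a * g x) \<in> V" if "g \<in> V" for g a
    using lin[OF that that, of a 0] by simp
  have null: "g = (\<lambda>_. 0)" if "g \<in> V" "?i g g = 0" for g
    using V that wip_self_eq_0[of g] by (fastforce simp: closed_subspace_on_def)
  have normal: "(\<lambda>x. 1 / sqrt (?i g g) * g x) \<in> ?S" if "g \<in> V" "g \<noteq> (\<lambda>_. 0)" for g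
  proof -
    have "?i g g > 0" using null[OF that(1)] that(2) wip_self_nonneg[of g] by fastforce
    hence "1 / sqrt (?i g g) * (1 / sqrt (?i g g) * ?i g g) = 1" by (simp add: divide_simps)
    thus ?thesis using scale[OF that(1)]
      by (simp add: wip_scale_left wip_scale_right del: times_divide_eq_left)
  qed
  have "?S \<noteq> {}" using normal[OF nontriv] by blast
  moreover have "continuous_on ?S (\<lambda>g. ?i g (?A g))"
    by (intro continuous_intros continuous_on_subset[OF continuous_on_product_coordinates subset_UNIV])
  ultimately obtain h where h: "h \<in> ?S" and max: "\<And>g. g \<in> ?S \<Longrightarrow> ?i g (?A g) \<le> ?i h (?A h)"
    using continuous_attains_sup[OF compact_unit_sphere[OF V]] by blast
  define \<theta> where "\<theta> = ?i h (?A h)"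
  have le: "?i g (?A g) \<le> \<theta> * ?i g g" if "g \<in> V" for g
  proof (cases "g = (\<lambda>_. 0)")
    case True thus ?thesis by (simp add: wip_def)
  next
    case False
    have pos: "?i g g > 0" using null[OF that(1)] False wip_self_nonneg[of g] by fastforce
    let ?c = "1 / sqrt (?i g g)"
    have "?A (\<lambda>x. ?c * g x) = (\<lambda>x. ?c * ?A g x)" using kernel_op_lin[of K ?c g 0 g] by simp
    hence "?c * (?c * ?i g (?A g)) \<le> \<theta>"
      using max[OF normal[OF that False]] unfolding \<theta>_def
      by (simp add: wip_scale_left wip_scale_right del: times_divide_eq_left)
    also have "?c * (?c * ?i g (?A g)) = ?i g (?A g) / ?i g g"
      using pos by (simp add: divide_simps)
    finally show ?thesis using pos by (simp add: field_simps)
  qed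
  \<comment> \<open>The form \<open>\<theta> \<langle>g, g\<rangle> - \<langle>g, A g\<rangle>\<close> is nonnegative on \<open>V\<close> and vanishes at \<open>h\<close>, so
    \<open>h\<close> is a critical point of it.\<close>
  define B where "B g g' = \<theta> * ?i g g' - ?i g (?A g')" for g g'
  have hV: "h \<in> V" and h1: "?i h h = 1" using h by auto
  have crit: "B h g = 0" if "g \<in> V" for g
  proof (rule ccontr)
    assume ne: "B h g \<noteq> 0"
    have exp: "B (\<lambda>x. 1 * h x + s * g x) (\<lambda>x. 1 * h x + s * g x) = 2 * s * B h g + s\<^sup>2 * B g g" for s
    proof -
      have "?i g (?A h) = ?i h (?A g)" using kernel_op_selfadjoint[OF sym] wip_commute by metis
      moreover have "?i g h = ?i h g" by (rule wip_commute)
      moreover have "?i h (?A h) = \<theta>" by (simp add: \<theta>_def)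
      ultimately show ?thesis
        unfolding B_def kernel_op_lin wip_lin_left wip_lin_right
        using h1 by (simp add: algebra_simps power2_eq_square)
    qed
    have nonneg: "B k k \<ge> 0" if "k \<in> V" for k using le[OF that] by (simp add: B_def)
    define d where "d = B g g + 1"
    have d: "d > 0" using nonneg[OF that] by (simp add: d_def)
    \<comment> \<open>Moving from \<open>h\<close> a little in the direction of \<open>\<plusminus> g\<close> would make the form negative.\<close>
    have "0 \<le> 2 * (- B h g / d) * B h g + (- B h g / d)\<^sup>2 * (d - 1)"
      using nonneg[OF lin[OF hV that, of 1 "- B h g / d"]] exp[of "- B h g / d"] by (simp only: d_def add_diff_cancel_right')
    also have "\<dots> = - ((B h g)\<^sup>2 * (d + 1)) / d\<^sup>2"
    proof -
      have "2 * (- B h g / d) * B h g = - (2 * (B h g)\<^sup>2 * d) / d\<^sup>2"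
        using d by (simp add: power2_eq_square)
      moreover have "(- B h g / d)\<^sup>2 * (d - 1) = ((B h g)\<^sup>2 * (d - 1)) / d\<^sup>2"
        by (simp add: power_divide)
      ultimately show ?thesis by (simp add: add_divide_distrib[symmetric] algebra_simps)
    qed
    also have "\<dots> < 0" using ne d by (simp add: divide_neg_pos)
    finally show False by simp
  qed
  let ?r = "\<lambda>x. \<theta> * h x + (-1) * ?A h x"
  have rV: "?r \<in> V" using lin[OF hV inv[OF hV]] .
  have "?i ?r ?r = B h ?r"
    using wip_lin_left[of \<theta> h "- 1" "?A h" ?r] kernel_op_selfadjoint[OF sym, of h ?r]
    by (simp only: B_def mult_minus1)
  hence "?r = (\<lambda>_. 0)" using null[OF rV] crit[OF rV] by simp
  hence "?A h = (\<lambda>x. \<theta> * h x)" by (auto simp: fun_eq_iff)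
  moreover have "h \<noteq> (\<lambda>_. 0)" using h1 by (auto simp: wip_def)
  ultimately show ?thesis using that hV le by blast
qed

definition mean_zero :: "('s \<Rightarrow> real) set" where
  "mean_zero = {g. (\<forall>x. x \<notin> \<Omega> \<longrightarrow> g x = 0) \<and> (\<Sum>x\<in>\<Omega>. \<mu> x * g x) = 0}"

lemma subspace_mean_zero: "closed_subspace_on \<Omega> mean_zero"
proof -
  have "mean_zero = (\<Inter>x\<in>-\<Omega>. {g. g x = 0}) \<inter> {g. (\<Sum>x\<in>\<Omega>. \<mu> x * g x) = 0}"
    unfolding mean_zero_def by auto
  moreover have "closed \<dots>"
    by (intro closed_Int closed_INT ballI closed_Collect_eq continuous_intros
        continuous_on_product_coordinates)
  ultimately show ?thesis unfolding closed_subspace_on_def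
    by (simp add: mean_zero_def algebra_simps sum.distrib sum_distrib_left[symmetric])
qed

end

section \<open>Spectral bounds for reversible Markov chains\<close>

lemma kernel_power_Suc_right:
  assumes "finite \<Omega>" "x \<in> \<Omega>" "y \<in> \<Omega>"
  shows "kernel_power \<Omega> P (Suc k) x y = (\<Sum>z\<in>\<Omega>. kernel_power \<Omega> P k x z * P z y)"
  using assms(2)
proof (induction k arbitrary: x)
  case 0
  have "(\<Sum>z\<in>\<Omega>. P x z * (if z = y then 1 else 0)) = P x y"
    using sum.delta[OF assms(1), of y "\<lambda>z. P x z"] assms by (simp add: if_distrib cong: if_cong)
  moreover have "(\<Sum>z\<in>\<Omega>. (if x = z then 1 else 0) * P z y) = P x y"
    using sum.delta'[OF assms(1), of x "\<lambda>z. P z y"] 0 by (simp add: if_distrib if_distribR cong: if_cong)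
  ultimately show ?case by simp
next
  case (Suc k)
  have "kernel_power \<Omega> P (Suc (Suc k)) x y
      = (\<Sum>w\<in>\<Omega>. P x w * (\<Sum>z\<in>\<Omega>. kernel_power \<Omega> P k w z * P z y))"
    using Suc.IH by (subst kernel_power.simps(2)) (intro sum.cong refl, simp)
  also have "\<dots> = (\<Sum>w\<in>\<Omega>. \<Sum>z\<in>\<Omega>. P x w * kernel_power \<Omega> P k w z * P z y)"
    by (simp add: sum_distrib_left mult_ac)
  also have "\<dots> = (\<Sum>z\<in>\<Omega>. \<Sum>w\<in>\<Omega>. P x w * kernel_power \<Omega> P k w z * P z y)"
    by (rule sum.swap)
  also have "\<dots> = (\<Sum>z\<in>\<Omega>. kernel_power \<Omega> P (Suc k) x z * P z y)"
    by (simp add: sum_distrib_right)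
  finally show ?case .
qed

lemma kernel_op_kernel_power:
  assumes "finite \<Omega>" "\<And>x. x \<notin> \<Omega> \<Longrightarrow> f x = 0"
  shows "kernel_op \<Omega> (kernel_power \<Omega> P k) f = (kernel_op \<Omega> P ^^ k) f"
proof (induction k)
  case 0
  show ?case
  proof
    fix x
    have "(\<Sum>y\<in>\<Omega>. (if x = y then 1 else 0) * f y) = f x" if "x \<in> \<Omega>"
      using sum.delta'[OF assms(1), of x f] that by (simp add: if_distrib if_distribR cong: if_cong)
    thus "kernel_op \<Omega> (kernel_power \<Omega> P 0) f x = (kernel_op \<Omega> P ^^ 0) f x"
      using assms(2) by (simp add: kernel_op_def)
  qed
next
  case (Suc k)
  have "kernel_op \<Omega> (kernel_power \<Omega> P (Suc k)) f = kernel_op \<Omega> P (kernel_op \<Omega> (kernel_power \<Omega> P k) f)"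
  proof
    fix x
    have "(\<Sum>y\<in>\<Omega>. (\<Sum>z\<in>\<Omega>. P x z * kernel_power \<Omega> P k z y) * f y)
        = (\<Sum>y\<in>\<Omega>. \<Sum>z\<in>\<Omega>. P x z * (kernel_power \<Omega> P k z y * f y))"
      by (simp add: sum_distrib_right mult.assoc)
    also have "\<dots> = (\<Sum>z\<in>\<Omega>. \<Sum>y\<in>\<Omega>. P x z * (kernel_power \<Omega> P k z y * f y))" by (rule sum.swap)
    also have "\<dots> = (\<Sum>z\<in>\<Omega>. P x z * (\<Sum>y\<in>\<Omega>. kernel_power \<Omega> P k z y * f y))"
      by (simp add: sum_distrib_left)
    finally show "kernel_op \<Omega> (kernel_power \<Omega> P (Suc k)) f x
        = kernel_op \<Omega> P (kernel_op \<Omega> (kernel_power \<Omega> P k) f) x"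
      by (simp add: kernel_op_def)
  qed
  thus ?case using Suc.IH by (simp del: kernel_power.simps)
qed

lemma eigenvector_funpow:
  assumes "kernel_op \<Omega> P h = (\<lambda>x. \<kappa> * h x)"
  shows "(kernel_op \<Omega> P ^^ k) h = (\<lambda>x. \<kappa> ^ k * h x)"
proof (induction k)
  case (Suc k)
  have "kernel_op \<Omega> P (\<lambda>x. \<kappa> ^ k * h x) = (\<lambda>x. \<kappa> ^ k * kernel_op \<Omega> P h x)"
    by (auto simp: kernel_op_def sum_distrib_left mult_ac)
  thus ?case using Suc assms by (simp add: mult_ac)
qed simp

locale reversible_chain = weighted_space \<Omega> \<mu> for \<Omega> :: "'s set" and \<mu> :: "'s \<Rightarrow> real" +
  fixes P :: "'s \<Rightarrow> 's \<Rightarrow> real"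
  assumes weight_sum: "(\<Sum>x\<in>\<Omega>. \<mu> x) = 1"
    and kernel_nonneg: "x \<in> \<Omega> \<Longrightarrow> y \<in> \<Omega> \<Longrightarrow> P x y \<ge> 0"
    and kernel_sum: "x \<in> \<Omega> \<Longrightarrow> (\<Sum>y\<in>\<Omega>. P x y) = 1"
    and detailed_balance: "x \<in> \<Omega> \<Longrightarrow> y \<in> \<Omega> \<Longrightarrow> \<mu> x * P x y = \<mu> y * P y x"
begin

abbreviation ip where "ip \<equiv> wip \<Omega> \<mu>"
abbreviation A where "A \<equiv> kernel_op \<Omega> P"

definition dirichlet :: "('s \<Rightarrow> real) \<Rightarrow> real" where
  "dirichlet f = (\<Sum>x\<in>\<Omega>. \<Sum>y\<in>\<Omega>. \<mu> x * P x y * (f x - f y)\<^sup>2) / 2"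

lemma kernel_power_symmetric:
  assumes "x \<in> \<Omega>" "y \<in> \<Omega>"
  shows "\<mu> x * kernel_power \<Omega> P k x y = \<mu> y * kernel_power \<Omega> P k y x"
  using assms
proof (induction k arbitrary: x y)
  case (Suc k)
  have "\<mu> x * kernel_power \<Omega> P (Suc k) x y = (\<Sum>z\<in>\<Omega>. \<mu> x * P x z * kernel_power \<Omega> P k z y)"
    by (simp add: sum_distrib_left mult_ac)
  also have "\<dots> = (\<Sum>z\<in>\<Omega>. \<mu> y * (kernel_power \<Omega> P k y z * P z x))"
  proof (rule sum.cong[OF refl])
    fix z assume z: "z \<in> \<Omega>"
    have "\<mu> x * P x z * kernel_power \<Omega> P k z y = P z x * (\<mu> z * kernel_power \<Omega> P k z y)"
      using detailed_balance[OF Suc.prems(1) z] by simp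
    thus "\<mu> x * P x z * kernel_power \<Omega> P k z y = \<mu> y * (kernel_power \<Omega> P k y z * P z x)"
      using Suc.IH[OF z Suc.prems(2)] by simp
  qed
  also have "\<dots> = \<mu> y * kernel_power \<Omega> P (Suc k) y x"
    by (subst kernel_power_Suc_right[OF finite_states Suc.prems(2,1)]) (simp add: sum_distrib_left)
  finally show ?case .
qed simp

lemma A_selfadjoint: "ip (A f) g = ip f (A g)"
  by (rule kernel_op_selfadjoint) (rule detailed_balance)

lemma funpow_A_selfadjoint: "ip ((A ^^ k) f) g = ip f ((A ^^ k) g)"
  by (induction k arbitrary: g) (simp_all add: A_selfadjoint funpow_swap1[symmetric])

lemma A_preserves_mean: "(\<Sum>x\<in>\<Omega>. \<mu> x * A f x) = (\<Sum>x\<in>\<Omega>. \<mu> x * f x)"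
proof -
  have "A (\<lambda>_. 1) x = 1" if "x \<in> \<Omega>" for x using that by (simp add: kernel_op_def kernel_sum)
  hence "ip (A f) (\<lambda>_. 1) = ip f (\<lambda>_. 1)"
    unfolding A_selfadjoint by (simp add: wip_def)
  thus ?thesis by (simp add: wip_def)
qed

lemma A_mean_zero: "g \<in> mean_zero \<Longrightarrow> A g \<in> mean_zero"
  unfolding mean_zero_def by (simp add: A_preserves_mean) (simp add: kernel_op_def)

lemma funpow_A_mean_zero: "g \<in> mean_zero \<Longrightarrow> (A ^^ k) g \<in> mean_zero"
  by (induction k) (simp_all add: A_mean_zero)

text \<open>
  Functional calculus for \<open>q(A) = (\<Sum>i\<in>I. c i * A ^ e i)\<close>: a bound of the polynomial on the eigenvalues
  of \<open>A\<close> bounds the quadratic form of \<open>q(A)\<close>, without an eigenbasis. The maximum of the form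
  is an eigenvalue \<open>\<theta>\<close> of \<open>q(A)\<close>. Its eigenspace is invariant under \<open>A\<close>, hence contains an
  eigenvector of \<open>A\<close>, and \<open>\<theta>\<close> is the value of \<open>q\<close> at the corresponding eigenvalue.
  
  The exponents are a family and not \<open>0, 1, 2, \<dots>\<close>, so that double sums over time indices can be
  used as they stand.
\<close>

lemma polynomial_form_le:
  fixes c :: "'i \<Rightarrow> real" and e :: "'i \<Rightarrow> nat"
  assumes ev: "\<And>h \<kappa>. h \<in> mean_zero \<Longrightarrow> h \<noteq> (\<lambda>_. 0) \<Longrightarrow> A h = (\<lambda>x. \<kappa> * h x) \<Longrightarrow>
      (\<Sum>i\<in>I. c i * \<kappa> ^ e i) \<le> B"
    and g: "g \<in> mean_zero"
  shows "(\<Sum>i\<in>I. c i * ip g ((A ^^ e i) g)) \<le> B * ip g g"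
proof (cases "g = (\<lambda>_. 0)")
  case True
  thus ?thesis by (simp add: wip_def)
next
  case False
  define K where "K x y = (\<Sum>i\<in>I. c i * kernel_power \<Omega> P (e i) x y)" for x y
  let ?T = "kernel_op \<Omega> K"
  have T: "?T f = (\<lambda>x. \<Sum>i\<in>I. c i * (A ^^ e i) f x)" if f: "\<And>x. x \<notin> \<Omega> \<Longrightarrow> f x = 0" for f
  proof
    fix x
    have "?T f x = (\<Sum>i\<in>I. c i * kernel_op \<Omega> (kernel_power \<Omega> P (e i)) f x)"
      unfolding K_def kernel_op_def
      by (auto simp: sum_distrib_right sum_distrib_left mult.assoc intro: sum.swap)
    thus "?T f x = (\<Sum>i\<in>I. c i * (A ^^ e i) f x)"
      by (simp add: kernel_op_kernel_power[OF finite_states f])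
  qed
  have supp: "x \<notin> \<Omega> \<Longrightarrow> f x = 0" if "f \<in> mean_zero" for f x
    using that by (simp add: mean_zero_def)
  have T0: "?T f = (\<lambda>x. \<Sum>i\<in>I. c i * (A ^^ e i) f x)" if "f \<in> mean_zero" for f
    by (rule T) (rule supp[OF that])
  have ipT: "ip f (?T f) = (\<Sum>i\<in>I. c i * ip f ((A ^^ e i) f))" if "f \<in> mean_zero" for f
  proof -
    have "ip f (?T f) = (\<Sum>x\<in>\<Omega>. \<Sum>i\<in>I. c i * (\<mu> x * f x * (A ^^ e i) f x))"
      unfolding T0[OF that] wip_def by (simp add: sum_distrib_left mult_ac)
    also have "\<dots> = (\<Sum>i\<in>I. \<Sum>x\<in>\<Omega>. c i * (\<mu> x * f x * (A ^^ e i) f x))" by (rule sum.swap)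
    finally show ?thesis by (simp add: wip_def sum_distrib_left)
  qed
  have symK: "\<mu> x * K x y = \<mu> y * K y x" if "x \<in> \<Omega>" "y \<in> \<Omega>" for x y
  proof -
    have "\<mu> x * K x y = (\<Sum>i\<in>I. c i * (\<mu> x * kernel_power \<Omega> P (e i) x y))"
      by (simp add: K_def sum_distrib_left mult.left_commute)
    also have "\<dots> = (\<Sum>i\<in>I. c i * (\<mu> y * kernel_power \<Omega> P (e i) y x))"
      by (simp only: kernel_power_symmetric[OF that])
    also have "\<dots> = \<mu> y * K y x"
      by (simp add: K_def sum_distrib_left mult.left_commute)
    finally show ?thesis .
  qed
  have Tinv: "?T f \<in> mean_zero" if "f \<in> mean_zero" for f
  proof -
    have "(\<Sum>x\<in>\<Omega>. \<mu> x * ?T f x) = (\<Sum>x\<in>\<Omega>. \<Sum>i\<in>I. c i * (\<mu> x * (A ^^ e i) f x))"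
      unfolding T0[OF that] by (simp add: sum_distrib_left mult_ac)
    also have "\<dots> = (\<Sum>i\<in>I. c i * (\<Sum>x\<in>\<Omega>. \<mu> x * (A ^^ e i) f x))"
      by (subst sum.swap) (simp add: sum_distrib_left)
    also have "\<dots> = 0" using funpow_A_mean_zero[OF that] by (simp add: mean_zero_def)
    finally show ?thesis unfolding mean_zero_def by (simp add: kernel_op_def)
  qed
  have TA: "?T (A f) = A (?T f)" if "f \<in> mean_zero" for f
  proof
    fix x
    have "?T (A f) x = (\<Sum>i\<in>I. c i * A ((A ^^ e i) f) x)"
      unfolding T0[OF A_mean_zero[OF that]] by (simp add: funpow_swap1)
    also have "\<dots> = A (?T f) x"
      unfolding T0[OF that] kernel_op_def[of \<Omega> P]
      by (auto simp: sum_distrib_left mult.left_commute intro: sum.swap)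
    finally show "?T (A f) x = A (?T f) x" .
  qed
  obtain h \<theta> where h: "h \<in> mean_zero" "h \<noteq> (\<lambda>_. 0)" "?T h = (\<lambda>x. \<theta> * h x)"
    and max: "\<And>f. f \<in> mean_zero \<Longrightarrow> ip f (?T f) \<le> \<theta> * ip f f"
    using rayleigh_maximiser_is_eigenvector[OF subspace_mean_zero g False symK Tinv] by blast
  define W where "W = {f \<in> mean_zero. ?T f = (\<lambda>x. \<theta> * f x)}"
  have W: "closed_subspace_on \<Omega> W"
  proof -
    have "W = mean_zero \<inter> (\<Inter>x. {f. ?T f x = \<theta> * f x})" by (auto simp: W_def fun_eq_iff)
    moreover have "closed (\<Inter>x. {f. ?T f x = \<theta> * f x})"
      by (intro closed_INT ballI closed_Collect_eq continuous_intros continuous_on_product_coordinates)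
    ultimately have "closed W" using subspace_mean_zero by (auto simp: closed_subspace_on_def)
    moreover have "(\<lambda>_. 0) \<in> W"
      using subspace_mean_zero by (auto simp: W_def closed_subspace_on_def kernel_op_def)
    moreover have "(\<lambda>x. a * f x + b * f' x) \<in> W" if "f \<in> W" "f' \<in> W" for f f' a b
      using subspace_mean_zero that
      by (auto simp: W_def closed_subspace_on_def kernel_op_lin algebra_simps)
    ultimately show ?thesis
      using subspace_mean_zero by (auto simp: closed_subspace_on_def W_def)
  qed
  have Winv: "A f \<in> W" if "f \<in> W" for f
    using that kernel_op_lin[of P \<theta> f 0 f]
    by (auto simp: W_def A_mean_zero TA)
  have hW: "h \<in> W" using h by (simp add: W_def)
  obtain h' \<kappa> where h': "h' \<in> W" "h' \<noteq> (\<lambda>_. 0)" "A h' = (\<lambda>x. \<kappa> * h' x)"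
    using rayleigh_maximiser_is_eigenvector[OF W hW h(2) detailed_balance Winv] by blast
  have h'0: "h' \<in> mean_zero" using h'(1) by (simp add: W_def)
  obtain x where x: "h' x \<noteq> 0" using h'(2) by auto
  have "\<theta> * h' x = (\<Sum>i\<in>I. c i * (A ^^ e i) h' x)"
    using h'(1) T0[OF h'0] by (auto simp: W_def fun_eq_iff)
  also have "\<dots> = (\<Sum>i\<in>I. c i * \<kappa> ^ e i) * h' x"
    by (simp add: eigenvector_funpow[OF h'(3)] sum_distrib_right mult.assoc)
  finally have "\<theta> = (\<Sum>i\<in>I. c i * \<kappa> ^ e i)" using x by simp
  hence "\<theta> \<le> B" using ev[OF h'0 h'(2,3)] by simp
  hence "\<theta> * ip g g \<le> B * ip g g" by (rule mult_right_mono) (rule wip_self_nonneg)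
  thus ?thesis using max[OF g] ipT[OF g] by simp
qed

text \<open>
  The cases \<open>s = - 1\<close> and \<open>s = 1\<close> give the Dirichlet form and the bound \<open>- 1\<close> for the spectrum.
\<close>

lemma sum_kernel_square:
  "(\<Sum>x\<in>\<Omega>. \<Sum>y\<in>\<Omega>. \<mu> x * P x y * (f x + s * f y)\<^sup>2) = (1 + s\<^sup>2) * ip f f + 2 * s * ip f (A f)"
proof -
  have 1: "(\<Sum>x\<in>\<Omega>. \<Sum>y\<in>\<Omega>. \<mu> x * P x y * (f x)\<^sup>2) = ip f f"
  proof -
    have "(\<Sum>y\<in>\<Omega>. \<mu> x * P x y * (f x)\<^sup>2) = \<mu> x * f x * f x" if "x \<in> \<Omega>" for x
    proof -
      have "(\<Sum>y\<in>\<Omega>. \<mu> x * P x y * (f x)\<^sup>2) = (\<mu> x * (f x)\<^sup>2) * (\<Sum>y\<in>\<Omega>. P x y)"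
        by (simp only: sum_distrib_left) (simp add: mult_ac)
      thus ?thesis using kernel_sum[OF that] by (simp add: power2_eq_square)
    qed
    thus ?thesis by (simp add: wip_def)
  qed
  have "(\<Sum>x\<in>\<Omega>. \<Sum>y\<in>\<Omega>. \<mu> x * P x y * (f y)\<^sup>2) = (\<Sum>y\<in>\<Omega>. \<Sum>x\<in>\<Omega>. \<mu> x * P x y * (f y)\<^sup>2)"
    by (rule sum.swap)
  also have "\<dots> = (\<Sum>y\<in>\<Omega>. \<Sum>x\<in>\<Omega>. \<mu> y * P y x * (f y)\<^sup>2)"
    by (intro sum.cong refl) (simp add: detailed_balance)
  finally have 2: "(\<Sum>x\<in>\<Omega>. \<Sum>y\<in>\<Omega>. \<mu> x * P x y * (f y)\<^sup>2) = ip f f" using 1 by simp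
  have 3: "(\<Sum>x\<in>\<Omega>. \<Sum>y\<in>\<Omega>. \<mu> x * P x y * (f x * f y)) = ip f (A f)"
    unfolding wip_def kernel_op_def
    by (auto simp: sum_distrib_left mult_ac intro!: sum.cong)
  have "(\<Sum>x\<in>\<Omega>. \<Sum>y\<in>\<Omega>. \<mu> x * P x y * (f x + s * f y)\<^sup>2)
      = (\<Sum>x\<in>\<Omega>. \<Sum>y\<in>\<Omega>. \<mu> x * P x y * (f x)\<^sup>2 + s\<^sup>2 * (\<mu> x * P x y * (f y)\<^sup>2)
           + 2 * s * (\<mu> x * P x y * (f x * f y)))"
    by (intro sum.cong refl) (simp add: power2_eq_square algebra_simps)
  also have "\<dots> = ip f f + s\<^sup>2 * ip f f + 2 * s * ip f (A f)"
    by (simp only: sum.distrib sum_distrib_left[symmetric] 1 2 3)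
  finally show ?thesis by (simp add: algebra_simps)
qed

lemma dirichlet_eq: "dirichlet f = ip f f - ip f (A f)"
  using sum_kernel_square[of f "- 1"] by (simp add: dirichlet_def)

lemma ip_A_ge: "ip f (A f) \<ge> - ip f f"
proof -
  have "0 \<le> (\<Sum>x\<in>\<Omega>. \<Sum>y\<in>\<Omega>. \<mu> x * P x y * (f x + 1 * f y)\<^sup>2)"
    by (intro sum_nonneg mult_nonneg_nonneg) (simp_all add: weight_pos less_imp_le kernel_nonneg)
  thus ?thesis unfolding sum_kernel_square by simp
qed

text \<open>
  The Poincare inequality \<open>gap\<close> keeps the spectrum away from \<open>1\<close>. Nothing keeps it away from
  \<open>- 1\<close>: a Wolff step on a cycle with a single site is a deterministic flip.
\<close>

lemma eigenvalue_bounds: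
  assumes gap: "\<And>g. g \<in> mean_zero \<Longrightarrow> ip g g \<le> C * dirichlet g"
    and h: "h \<in> mean_zero" "h \<noteq> (\<lambda>_. 0)" "A h = (\<lambda>x. \<kappa> * h x)"
  shows "- 1 \<le> \<kappa>" "1 \<le> C * (1 - \<kappa>)"
proof -
  have "ip h h \<noteq> 0" using h wip_self_eq_0[of h] by (auto simp: mean_zero_def)
  hence pos: "ip h h > 0" using wip_self_nonneg[of h] by linarith
  have ipA: "ip h (A h) = \<kappa> * ip h h" by (simp add: h(3) wip_scale_right)
  have "(- 1) * ip h h \<le> \<kappa> * ip h h" using ip_A_ge[of h] ipA by simp
  thus "- 1 \<le> \<kappa>" using pos by (simp only: mult_le_cancel_right)
  have "1 * ip h h \<le> (C * (1 - \<kappa>)) * ip h h"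
    using gap[OF h(1)] by (simp add: dirichlet_eq ipA algebra_simps)
  thus "1 \<le> C * (1 - \<kappa>)" using pos by (simp only: mult_le_cancel_right)
qed

end

text \<open>
  The sum is \<open>\<kappa> (1 - \<kappa> ^ M) / (1 - \<kappa>)\<close>. If \<open>\<kappa> \<ge> 0\<close>, the numerator lies in \<open>[0, 1]\<close> and the gap
  bounds the quotient by \<open>C\<close>. If \<open>\<kappa> < 0\<close>, its absolute value is at most \<open>2 \<bar>\<kappa>\<bar> \<le> 1 + \<bar>\<kappa>\<bar>\<close>, so that
  the quotient is at most \<open>1\<close> in absolute value.
\<close>

lemma abs_sum_powers_le:
  fixes \<kappa> :: real
  assumes "- 1 \<le> \<kappa>" "1 \<le> C * (1 - \<kappa>)" "C > 0"
  shows "\<bar>\<Sum>k=1..M. \<kappa> ^ k\<bar> \<le> 1 + C"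
proof -
  have "0 < C * (1 - \<kappa>)" using assms(2) by linarith
  hence lt: "\<kappa> < 1" using assms(3) by (simp add: zero_less_mult_iff)
  have abs1: "\<bar>\<kappa>\<bar> \<le> 1" using assms(1) lt by auto
  have tele: "(1 - \<kappa>) * (\<Sum>k=1..M. \<kappa> ^ k) = \<kappa> * (1 - \<kappa> ^ M)"
  proof (induction M)
    case (Suc M)
    have "(1 - \<kappa>) * (\<Sum>k=1..Suc M. \<kappa> ^ k) = \<kappa> * (1 - \<kappa> ^ M) + (1 - \<kappa>) * \<kappa> ^ Suc M"
      using Suc by (simp add: distrib_left)
    also have "\<dots> = \<kappa> * (1 - \<kappa> ^ Suc M)" by (simp add: algebra_simps)
    finally show ?case .
  qed simp
  have eq: "\<bar>\<Sum>k=1..M. \<kappa> ^ k\<bar> = \<bar>\<kappa>\<bar> * \<bar>1 - \<kappa> ^ M\<bar> / (1 - \<kappa>)"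
  proof -
    have "(\<Sum>k=1..M. \<kappa> ^ k) = \<kappa> * (1 - \<kappa> ^ M) / (1 - \<kappa>)"
      using tele lt by (simp only: tele[symmetric]) simp
    thus ?thesis using lt by (simp only: abs_mult abs_divide)
  qed
  show ?thesis
  proof (cases "\<kappa> \<ge> 0")
    case True
    have "\<bar>\<kappa>\<bar> * \<bar>1 - \<kappa> ^ M\<bar> \<le> 1 * 1"
      using True lt by (intro mult_mono) (auto simp: power_le_one)
    also have "\<dots> \<le> C * (1 - \<kappa>)" using assms(2) by simp
    also have "\<dots> \<le> (1 + C) * (1 - \<kappa>)" using lt by (simp add: algebra_simps)
    finally show ?thesis unfolding eq using lt by (simp add: divide_le_eq)
  next
    case False
    have "\<bar>\<kappa> ^ M\<bar> \<le> 1" using abs1 by (simp add: power_abs power_le_one)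
    hence "\<bar>\<kappa>\<bar> * \<bar>1 - \<kappa> ^ M\<bar> \<le> \<bar>\<kappa>\<bar> * 2" by (intro mult_left_mono) auto
    also have "\<dots> \<le> 1 * (1 - \<kappa>)" using False assms(1) by simp
    also have "\<dots> \<le> (1 + C) * (1 - \<kappa>)" using lt assms(3) by (intro mult_right_mono) auto
    finally show ?thesis unfolding eq using lt by (simp add: divide_le_eq)
  qed
qed

text \<open>
  Both geometric sums, to the left and to the right of \<open>k\<close>, together give
  \<open>(1 + \<kappa> - \<kappa> ^ k - \<kappa> ^ (M - k + 1)) / (1 - \<kappa>) \<le> (1 + \<bar>\<kappa>\<bar>) / (1 - \<kappa>)\<close>. This is at most
  \<open>2 / (1 - \<kappa>)\<close> for \<open>\<kappa> \<ge> 0\<close>, and it equals \<open>1\<close> for \<open>\<kappa> < 0\<close>, which is why \<open>C \<ge> 1 / 2\<close> is assumed.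
\<close>

lemma sum_power_dist_le:
  fixes \<kappa> :: real
  assumes "- 1 \<le> \<kappa>" "1 \<le> C * (1 - \<kappa>)" "C \<ge> 1 / 2" "k \<in> {1..M}"
  shows "(\<Sum>l=1..M. \<kappa> ^ ((k - l) + (l - k))) \<le> 2 * C"
proof -
  have "0 < C * (1 - \<kappa>)" using assms(2) by linarith
  hence lt: "\<kappa> < 1" using assms(3) by (simp add: zero_less_mult_iff)
  have abs1: "\<bar>\<kappa>\<bar> \<le> 1" using assms(1) lt by auto
  have pw: "- (\<kappa> ^ n) \<le> max 0 (- \<kappa>)" if "n \<ge> 1" for n
  proof (cases "\<kappa> \<ge> 0")
    case False
    have "- (\<kappa> ^ n) \<le> \<bar>\<kappa>\<bar> ^ n" by (metis abs_ge_minus_self power_abs)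
    also have "\<dots> \<le> \<bar>\<kappa>\<bar> ^ 1" using that abs1 by (intro power_decreasing) auto
    finally show ?thesis using False by simp
  qed simp
  have left: "(1 - \<kappa>) * (\<Sum>l=1..k. \<kappa> ^ (k - l)) = 1 - \<kappa> ^ k" for k
  proof (induction k)
    case (Suc k)
    have "(\<Sum>l=1..Suc k. \<kappa> ^ (Suc k - l)) = \<kappa> * (\<Sum>l=1..k. \<kappa> ^ (k - l)) + 1"
      by (simp add: sum_distrib_left Suc_diff_le)
    hence "(1 - \<kappa>) * (\<Sum>l=1..Suc k. \<kappa> ^ (Suc k - l))
        = \<kappa> * ((1 - \<kappa>) * (\<Sum>l=1..k. \<kappa> ^ (k - l))) + (1 - \<kappa>)"
      by (simp add: algebra_simps)
    thus ?case unfolding Suc by (simp add: algebra_simps)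
  qed simp
  have right: "(1 - \<kappa>) * (\<Sum>l=Suc k..k + n. \<kappa> ^ (l - k)) = \<kappa> - \<kappa> ^ (Suc n)" for n
  proof (induction n)
    case (Suc n)
    have "(1 - \<kappa>) * (\<Sum>l=Suc k..k + Suc n. \<kappa> ^ (l - k))
        = (\<kappa> - \<kappa> ^ Suc n) + (1 - \<kappa>) * \<kappa> ^ Suc n"
      using Suc by (simp add: distrib_left)
    also have "\<dots> = \<kappa> - \<kappa> ^ Suc (Suc n)" by (simp add: algebra_simps)
    finally show ?case .
  qed simp
  have k: "1 \<le> k" "k \<le> M" using assms(4) by auto
  then obtain n where n: "M = k + n" using le_Suc_ex by blast
  have "(\<Sum>l=1..M. \<kappa> ^ ((k - l) + (l - k))) =
      (\<Sum>l=1..k. \<kappa> ^ ((k - l) + (l - k))) + (\<Sum>l=Suc k..k + n. \<kappa> ^ ((k - l) + (l - k)))"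
    unfolding n using k by (subst sum.ub_add_nat) auto
  also have "(\<Sum>l=1..k. \<kappa> ^ ((k - l) + (l - k))) = (\<Sum>l=1..k. \<kappa> ^ (k - l))"
    by (intro sum.cong) auto
  also have "(\<Sum>l=Suc k..k + n. \<kappa> ^ ((k - l) + (l - k))) = (\<Sum>l=Suc k..k + n. \<kappa> ^ (l - k))"
    by (intro sum.cong) auto
  finally have "(1 - \<kappa>) * (\<Sum>l=1..M. \<kappa> ^ ((k - l) + (l - k))) = 1 + \<kappa> - \<kappa> ^ k - \<kappa> ^ (Suc n)"
    using left[of k] right[of n] by (simp add: distrib_left)
  also have "\<dots> \<le> 1 + \<kappa> + 2 * max 0 (- \<kappa>)"
    using pw[of k] pw[of "Suc n"] k by simp
  also have "\<dots> \<le> (1 - \<kappa>) * (2 * C)"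
  proof (cases "\<kappa> \<ge> 0")
    case True thus ?thesis using assms(2) lt by (simp add: algebra_simps)
  next
    case False
    have "(1 - \<kappa>) * 1 \<le> (1 - \<kappa>) * (2 * C)" using lt assms(3) by (intro mult_left_mono) auto
    thus ?thesis using False by simp
  qed
  finally show ?thesis using lt by simp
qed

context reversible_chain
begin

lemma norm_ergodic_sum_le:
  assumes gap: "\<And>g. g \<in> mean_zero \<Longrightarrow> ip g g \<le> C * dirichlet g" and "C > 0"
    and g: "g \<in> mean_zero"
  shows "ip (\<lambda>x. \<Sum>k=1..M. (A ^^ k) g x) (\<lambda>x. \<Sum>k=1..M. (A ^^ k) g x) \<le> (1 + C)\<^sup>2 * ip g g"
proof -
  have "ip (\<lambda>x. \<Sum>k=1..M. (A ^^ k) g x) (\<lambda>x. \<Sum>k=1..M. (A ^^ k) g x)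
      = (\<Sum>x\<in>\<Omega>. \<Sum>p\<in>{1..M}\<times>{1..M}. \<mu> x * (A ^^ fst p) g x * (A ^^ snd p) g x)"
    unfolding wip_def mult.assoc sum_product
    by (intro sum.cong refl)
       (simp add: sum_distrib_left sum_distrib_right sum.cartesian_product case_prod_beta mult_ac)
  also have "\<dots> = (\<Sum>p\<in>{1..M}\<times>{1..M}. ip ((A ^^ fst p) g) ((A ^^ snd p) g))"
    by (subst sum.swap) (simp add: wip_def)
  also have "\<dots> = (\<Sum>p\<in>{1..M}\<times>{1..M}. 1 * ip g ((A ^^ (fst p + snd p)) g))"
    by (simp add: funpow_A_selfadjoint funpow_add)
  also have "\<dots> \<le> (1 + C)\<^sup>2 * ip g g"
  proof (rule polynomial_form_le[OF _ g])
    fix h \<kappa> assume "h \<in> mean_zero" "h \<noteq> (\<lambda>_. 0)" "A h = (\<lambda>x. \<kappa> * h x)"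
    note ev = eigenvalue_bounds[OF gap this]
    have "(\<Sum>p\<in>{1..M}\<times>{1..M}. 1 * \<kappa> ^ (fst p + snd p)) = (\<Sum>k=1..M. \<kappa> ^ k)\<^sup>2"
      by (simp add: power2_eq_square sum_product sum.cartesian_product case_prod_beta power_add)
    also have "\<dots> \<le> (1 + C)\<^sup>2"
      using abs_sum_powers_le[OF ev \<open>C > 0\<close>, of M] power_mono[of "\<bar>\<Sum>k=1..M. \<kappa> ^ k\<bar>" "1 + C" 2] by simp
    finally show "(\<Sum>p\<in>{1..M}\<times>{1..M}. 1 * \<kappa> ^ (fst p + snd p)) \<le> (1 + C)\<^sup>2" .
  qed
  finally show ?thesis .
qed

lemma sum_correlations_le:
  assumes gap: "\<And>g. g \<in> mean_zero \<Longrightarrow> ip g g \<le> C * dirichlet g" and C: "C \<ge> 1 / 2"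
    and g: "g \<in> mean_zero"
  shows "(\<Sum>k=1..M. \<Sum>l=1..M. ip g ((A ^^ ((k - l) + (l - k))) g)) \<le> real M * (2 * C) * ip g g"
proof -
  have "(\<Sum>p\<in>{1..M}\<times>{1..M}. 1 * ip g ((A ^^ ((fst p - snd p) + (snd p - fst p))) g))
      \<le> real M * (2 * C) * ip g g"
  proof (rule polynomial_form_le[OF _ g])
    fix h \<kappa> assume "h \<in> mean_zero" "h \<noteq> (\<lambda>_. 0)" "A h = (\<lambda>x. \<kappa> * h x)"
    note ev = eigenvalue_bounds[OF gap this]
    have "(\<Sum>p\<in>{1..M}\<times>{1..M}. 1 * \<kappa> ^ ((fst p - snd p) + (snd p - fst p)))
        = (\<Sum>k=1..M. \<Sum>l=1..M. \<kappa> ^ ((k - l) + (l - k)))"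
      by (simp add: sum.cartesian_product case_prod_beta)
    also have "\<dots> \<le> (\<Sum>k=1..M. 2 * C)"
      by (intro sum_mono sum_power_dist_le[OF ev C])
    finally show "(\<Sum>p\<in>{1..M}\<times>{1..M}. 1 * \<kappa> ^ ((fst p - snd p) + (snd p - fst p))) \<le> real M * (2 * C)"
      by simp
  qed
  thus ?thesis by (simp add: sum.cartesian_product case_prod_beta)
qed

end

section \<open>Correlations of a stationary chain\<close>

lemma markov_chain_state:
  assumes "markov_chain S Y \<Omega> \<mu> P" "j \<ge> 1" "w \<in> space S"
  shows "Y j w \<in> \<Omega>"
  using assms measurable_space[of "Y j" S "count_space \<Omega>" w] by (auto simp: markov_chain_def)

lemma markov_chain_event:
  assumes mc: "markov_chain S Y \<Omega> \<mu> P" and j: "j \<ge> 1"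
  shows "{w \<in> space S. Y j w = c} \<in> sets S"
proof -
  have m: "Y j \<in> measurable S (count_space \<Omega>)" using mc j by (simp add: markov_chain_def)
  have "{w \<in> space S. Y j w = c} = Y j -` ({c} \<inter> \<Omega>) \<inter> space S"
    using markov_chain_state[OF mc j] by auto
  thus ?thesis using measurable_sets[OF m, of "{c} \<inter> \<Omega>"] by simp
qed

text \<open>
  The Markov property is given for complete paths. Here it is summed over all paths that pass
  through \<open>a\<close> at time \<open>k\<close> and end in \<open>z\<close> at time \<open>n\<close>.
\<close>

lemma markov_chain_pair_step:
  assumes mc: "markov_chain S Y \<Omega> \<mu> P" and fin: "finite \<Omega>"
    and k: "1 \<le> k" "k \<le> n" and ab: "a \<in> \<Omega>" "z \<in> \<Omega>" "b \<in> \<Omega>"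
  shows "measure S {w \<in> space S. Y k w = a \<and> Y n w = z \<and> Y (Suc n) w = b}
       = measure S {w \<in> space S. Y k w = a \<and> Y n w = z} * P z b"
proof -
  interpret prob_space S using mc by (simp add: markov_chain_def)
  define X where "X = {x \<in> PiE {1..n} (\<lambda>_. \<Omega>). x k = a \<and> x n = z}"
  define D where "D n x = {w \<in> space S. \<forall>k\<in>{1..n}. Y k w = x k}" for n :: nat and x :: "nat \<Rightarrow> 'b"
  note val = markov_chain_state[OF mc] and single = markov_chain_event[OF mc]
  have D: "D m x \<in> sets S" for m x
    unfolding D_def by (intro sets.sets_Collect_finite_All single) auto
  have finX: "finite X"
    unfolding X_def by (intro finite_subset[OF _ finite_PiE[of "{1..n}" "\<lambda>_. \<Omega>"]]) (auto simp: fin)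
  have dis: "disjoint_family_on (\<lambda>x. D n x) X"
    unfolding disjoint_family_on_def
  proof (intro ballI impI)
    fix x x' assume x: "x \<in> X" "x' \<in> X" "x \<noteq> x'"
    have "\<not> (\<forall>k\<in>{1..n}. x k = x' k)"
    proof
      assume eq: "\<forall>k\<in>{1..n}. x k = x' k"
      have "x = x'"
        by (rule PiE_ext[of x "{1..n}" "\<lambda>_. \<Omega>" x']) (use x eq in \<open>auto simp: X_def\<close>)
      with x(3) show False by contradiction
    qed
    then obtain k where k: "k \<in> {1..n}" "x k \<noteq> x' k" by blast
    show "D n x \<inter> D n x' = {}"
    proof (rule equals0I)
      fix w assume "w \<in> D n x \<inter> D n x'"
      hence "Y k w = x k" "Y k w = x' k" using k(1) unfolding D_def by blast+
      with k(2) show False by simp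
    qed
  qed
  \<comment> \<open>the extension of a path by the state at time \<open>n + 1\<close>\<close>
  let ?u = "\<lambda>x. x(Suc n := b)"
  have eqD: "D (Suc n) (?u x) = {w \<in> D n x. Y (Suc n) w = b}" for x
    by (auto simp: D_def atLeastAtMostSuc_conv)
  have dis': "disjoint_family_on (\<lambda>x. D (Suc n) (?u x)) X"
    using dis unfolding disjoint_family_on_def eqD by blast
  have paths: "\<exists>x\<in>X. \<forall>j\<in>{1..n}. Y j w = x j" if "w \<in> space S" "Y k w = a" "Y n w = z" for w
  proof
    show "restrict (\<lambda>j. Y j w) {1..n} \<in> X" using that val k by (auto simp: X_def)
  qed simp
  have "{w \<in> space S. Y k w = a \<and> Y n w = z} = (\<Union>x\<in>X. D n x)"
    using paths k by (auto simp: D_def X_def)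
  hence 1: "measure S {w \<in> space S. Y k w = a \<and> Y n w = z} = (\<Sum>x\<in>X. measure S (D n x))"
    using finite_measure_finite_Union[OF finX _ dis] D by auto
  have "{w \<in> space S. Y k w = a \<and> Y n w = z \<and> Y (Suc n) w = b} = (\<Union>x\<in>X. D (Suc n) (?u x))"
    unfolding eqD using paths k by (auto simp: D_def X_def)
  hence "measure S {w \<in> space S. Y k w = a \<and> Y n w = z \<and> Y (Suc n) w = b}
      = (\<Sum>x\<in>X. measure S (D (Suc n) (?u x)))"
    using finite_measure_finite_Union[OF finX _ dis'] D by auto
  also have "\<dots> = (\<Sum>x\<in>X. measure S (D n x) * P z b)"
  proof (rule sum.cong[OF refl])
    fix x assume x: "x \<in> X"
    have "\<forall>j\<in>{1..Suc n}. ?u x j \<in> \<Omega>" using x ab by (auto simp: X_def)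
    hence "measure S (D (Suc n) (?u x)) = measure S (D n (?u x)) * P (?u x n) (?u x (Suc n))"
      using mc k unfolding markov_chain_def D_def by (meson le_trans)
    moreover have "D n (?u x) = D n x" by (auto simp: D_def)
    moreover have "x n = z" using x by (simp add: X_def)
    ultimately show "measure S (D (Suc n) (?u x)) = measure S (D n x) * P z b" by simp
  qed
  finally show ?thesis unfolding 1 by (simp add: sum_distrib_right)
qed

lemma markov_chain_pair_marginal:
  assumes mc: "markov_chain S Y \<Omega> \<mu> P" and fin: "finite \<Omega>"
    and k: "1 \<le> k" "k \<le> n" and ab: "a \<in> \<Omega>" "b \<in> \<Omega>"
  shows "measure S {w \<in> space S. Y k w = a \<and> Y (Suc n) w = b}
       = (\<Sum>z\<in>\<Omega>. measure S {w \<in> space S. Y k w = a \<and> Y n w = z} * P z b)"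
proof -
  interpret prob_space S using mc by (simp add: markov_chain_def)
  note val = markov_chain_state[OF mc] and single = markov_chain_event[OF mc]
  have n: "n \<ge> 1" using k by simp
  have "{w \<in> space S. Y k w = a \<and> Y (Suc n) w = b}
      = (\<Union>z\<in>\<Omega>. {w \<in> space S. Y k w = a \<and> Y n w = z \<and> Y (Suc n) w = b})"
    using val n by auto
  also have "measure S \<dots>
      = (\<Sum>z\<in>\<Omega>. measure S {w \<in> space S. Y k w = a \<and> Y n w = z \<and> Y (Suc n) w = b})"
    using k n by (intro finite_measure_finite_Union fin)
      (auto simp: disjoint_family_on_def intro!: sets.sets_Collect_conj single)
  finally show ?thesis
    using markov_chain_pair_step[OF mc fin k ab(1) _ ab(2)] by simp
qed

lemma markov_chain_marginal:
  assumes mc: "markov_chain S Y \<Omega> \<mu> P" and fin: "finite \<Omega>"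
    and n: "n \<ge> 1" and b: "b \<in> \<Omega>"
  shows "measure S {w \<in> space S. Y (Suc n) w = b}
       = (\<Sum>z\<in>\<Omega>. measure S {w \<in> space S. Y n w = z} * P z b)"
proof -
  interpret prob_space S using mc by (simp add: markov_chain_def)
  note val = markov_chain_state[OF mc] and single = markov_chain_event[OF mc]
  have "{w \<in> space S. Y (Suc n) w = b} = (\<Union>z\<in>\<Omega>. {w \<in> space S. Y n w = z \<and> Y (Suc n) w = b})"
    using val n by auto
  also have "measure S \<dots> = (\<Sum>z\<in>\<Omega>. measure S {w \<in> space S. Y n w = z \<and> Y (Suc n) w = b})"
    using n by (intro finite_measure_finite_Union fin)
      (auto simp: disjoint_family_on_def intro!: sets.sets_Collect_conj single)
  also have "\<dots> = (\<Sum>z\<in>\<Omega>. measure S {w \<in> space S. Y n w = z} * P z b)"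
  proof (rule sum.cong[OF refl])
    fix z assume z: "z \<in> \<Omega>"
    show "measure S {w \<in> space S. Y n w = z \<and> Y (Suc n) w = b}
        = measure S {w \<in> space S. Y n w = z} * P z b"
      using markov_chain_pair_step[OF mc fin n order_refl z z b] by simp
  qed
  finally show ?thesis .
qed

context reversible_chain
begin

lemma marginal_stationary:
  assumes mc: "markov_chain S Y \<Omega> \<mu> P" and "1 \<le> k" "b \<in> \<Omega>"
  shows "measure S {w \<in> space S. Y k w = b} = \<mu> b"
  using assms(2,3)
proof (induction k arbitrary: b rule: dec_induct)
  case base
  thus ?case using mc by (simp add: markov_chain_def)
next
  case (step n)
  have "measure S {w \<in> space S. Y (Suc n) w = b} = (\<Sum>z\<in>\<Omega>. \<mu> z * P z b)"
    using markov_chain_marginal[OF mc finite_states step(1) step.prems] step.IH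
    by simp
  also have "\<dots> = (\<Sum>z\<in>\<Omega>. \<mu> b * P b z)" using detailed_balance step.prems by simp
  finally show ?case using kernel_sum[OF step.prems] by (simp add: sum_distrib_left[symmetric])
qed

lemma pair_law:
  assumes mc: "markov_chain S Y \<Omega> \<mu> P" and k: "1 \<le> k" and ab: "a \<in> \<Omega>" "b \<in> \<Omega>"
  shows "measure S {w \<in> space S. Y k w = a \<and> Y (k + d) w = b} = \<mu> a * kernel_power \<Omega> P d a b"
  using ab(2)
proof (induction d arbitrary: b)
  case 0
  show ?case
  proof (cases "a = b")
    case True
    thus ?thesis using marginal_stationary[OF mc k ab(1)] by simp
  next
    case False
    hence "{w \<in> space S. Y k w = a \<and> Y (k + 0) w = b} = {}" by auto
    hence "measure S {w \<in> space S. Y k w = a \<and> Y (k + 0) w = b} = 0" by (simp only: measure_empty)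
    thus ?thesis using False by simp
  qed
next
  case (Suc d)
  have "measure S {w \<in> space S. Y k w = a \<and> Y (k + Suc d) w = b}
      = (\<Sum>z\<in>\<Omega>. \<mu> a * kernel_power \<Omega> P d a z * P z b)"
    using markov_chain_pair_marginal[OF mc finite_states k le_add1 ab(1) Suc.prems, of d] Suc.IH by simp
  also have "\<dots> = \<mu> a * kernel_power \<Omega> P (Suc d) a b"
    by (subst kernel_power_Suc_right[OF finite_states ab(1) Suc.prems])
       (simp add: sum_distrib_left mult.assoc)
  finally show ?case .
qed

text \<open>
  For \<open>k \<le> l\<close> this follows from the joint law of \<open>Y k\<close> and \<open>Y l\<close>. The product is symmetric in
  \<open>k\<close> and \<open>l\<close>, and so is the exponent, which is the distance \<open>\<bar>k - l\<bar>\<close> written with truncated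
  subtraction.
\<close>

lemma expectation_product:
  assumes mc: "markov_chain S Y \<Omega> \<mu> P" and k: "1 \<le> k" "1 \<le> l"
    and g: "\<And>x. x \<notin> \<Omega> \<Longrightarrow> g x = 0"
  shows "integrable S (\<lambda>w. g (Y k w) * g (Y l w))"
    and "(\<integral>w. g (Y k w) * g (Y l w) \<partial>S) = ip g ((A ^^ ((k - l) + (l - k))) g)"
proof -
  have "integrable S (\<lambda>w. g (Y k w) * g (Y (k + d) w)) \<and>
     (\<integral>w. g (Y k w) * g (Y (k + d) w) \<partial>S) = ip g ((A ^^ d) g)" if k: "1 \<le> k" for k d
  proof -
    interpret prob_space S using mc by (simp add: markov_chain_def)
    let ?D = "\<lambda>p. {w \<in> space S. Y k w = fst p \<and> Y (k + d) w = snd p}"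
    note val = markov_chain_state[OF mc]
    have D: "?D p \<in> sets S" if "p \<in> \<Omega> \<times> \<Omega>" for p
      using k by (intro sets.sets_Collect_conj markov_chain_event[OF mc]) auto
    have eq: "g (Y k w) * g (Y (k + d) w) = (\<Sum>p\<in>\<Omega>\<times>\<Omega>. g (fst p) * g (snd p) * indicator (?D p) w)"
      if w: "w \<in> space S" for w
    proof -
      have "(\<Sum>p\<in>\<Omega>\<times>\<Omega>. g (fst p) * g (snd p) * indicator (?D p) w)
          = (\<Sum>p\<in>\<Omega>\<times>\<Omega>. if (Y k w, Y (k + d) w) = p then g (fst p) * g (snd p) else 0)"
        using w by (intro sum.cong refl) (auto simp: indicator_def)
      also have "\<dots> = g (Y k w) * g (Y (k + d) w)"
        using val[OF _ w] k finite_states by (subst sum.delta') auto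
      finally show ?thesis by simp
    qed
    have int: "integrable S (\<lambda>w. g (fst p) * g (snd p) * indicator (?D p) w)" if "p \<in> \<Omega> \<times> \<Omega>" for p
      using D[OF that] by (intro integrable_mult_right) (simp add: less_top[symmetric])
    have "integrable S (\<lambda>w. \<Sum>p\<in>\<Omega>\<times>\<Omega>. g (fst p) * g (snd p) * indicator (?D p) w)"
      by (intro Bochner_Integration.integrable_sum int)
    hence I: "integrable S (\<lambda>w. g (Y k w) * g (Y (k + d) w))"
      by (subst Bochner_Integration.integrable_cong[OF refl eq]) auto
    have "(\<integral>w. g (Y k w) * g (Y (k + d) w) \<partial>S)
        = (\<integral>w. (\<Sum>p\<in>\<Omega>\<times>\<Omega>. g (fst p) * g (snd p) * indicator (?D p) w) \<partial>S)"
      by (intro Bochner_Integration.integral_cong refl eq)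
    also have "\<dots> = (\<Sum>p\<in>\<Omega>\<times>\<Omega>. g (fst p) * g (snd p) * measure S (?D p))"
      by (subst Bochner_Integration.integral_sum[OF int])
         (auto intro!: sum.cong simp: D Int_absorb2)
    also have "\<dots> = (\<Sum>p\<in>\<Omega>\<times>\<Omega>. g (fst p) * g (snd p) * (\<mu> (fst p) * kernel_power \<Omega> P d (fst p) (snd p)))"
      by (intro sum.cong refl) (auto simp: pair_law[OF mc k])
    also have "\<dots> = ip g (kernel_op \<Omega> (kernel_power \<Omega> P d) g)"
      by (auto simp: wip_def kernel_op_def sum_distrib_left sum.cartesian_product case_prod_beta mult_ac
          intro!: sum.cong)
    also have "\<dots> = ip g ((A ^^ d) g)" by (simp add: kernel_op_kernel_power[OF finite_states g])
    finally show ?thesis using I by simp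
  qed note main = this
  show "integrable S (\<lambda>w. g (Y k w) * g (Y l w))"
    "(\<integral>w. g (Y k w) * g (Y l w) \<partial>S) = ip g ((A ^^ ((k - l) + (l - k))) g)"
    using main[of k "l - k"] main[of l "k - l"] k
    by (cases "k \<le> l"; simp add: mult.commute)+
qed

definition centred :: "('s \<Rightarrow> real) \<Rightarrow> 's \<Rightarrow> real" where
  "centred f x = (if x \<in> \<Omega> then f x - (\<Sum>y\<in>\<Omega>. f y * \<mu> y) else 0)"

lemma centred_mean_zero: "centred f \<in> mean_zero"
  using weight_sum
  by (simp add: mean_zero_def centred_def right_diff_distrib sum_subtractf
      sum_distrib_right[symmetric] mult.commute)

lemma ip_centred_le: "ip (centred f) (centred f) \<le> (\<Sum>x\<in>\<Omega>. (f x)\<^sup>2 * \<mu> x)"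
proof -
  let ?m = "\<Sum>y\<in>\<Omega>. f y * \<mu> y"
  have "ip (centred f) (centred f) = (\<Sum>x\<in>\<Omega>. (f x)\<^sup>2 * \<mu> x - 2 * ?m * (f x * \<mu> x) + ?m\<^sup>2 * \<mu> x)"
    unfolding wip_def centred_def by (intro sum.cong refl) (simp add: power2_eq_square algebra_simps)
  also have "\<dots> = (\<Sum>x\<in>\<Omega>. (f x)\<^sup>2 * \<mu> x) - 2 * ?m * ?m + ?m\<^sup>2 * 1"
    by (simp only: sum.distrib sum_subtractf sum_distrib_left[symmetric] weight_sum)
  finally show ?thesis by (simp add: power2_eq_square)
qed

lemma kernel_apply_centred:
  assumes "x \<in> \<Omega>"
  shows "kernel_apply \<Omega> P k f x = (A ^^ k) (centred f) x + (\<Sum>y\<in>\<Omega>. f y * \<mu> y)"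
proof -
  have one: "(\<Sum>y\<in>\<Omega>. kernel_power \<Omega> P k x y) = 1" using assms
  proof (induction k arbitrary: x)
    case 0 thus ?case using finite_states by simp
  next
    case (Suc k)
    have "(\<Sum>y\<in>\<Omega>. kernel_power \<Omega> P (Suc k) x y) = (\<Sum>z\<in>\<Omega>. P x z * (\<Sum>y\<in>\<Omega>. kernel_power \<Omega> P k z y))"
      by (simp add: sum_distrib_left) (rule sum.swap)
    thus ?case using Suc kernel_sum by simp
  qed
  have "(A ^^ k) (centred f) x = (\<Sum>y\<in>\<Omega>. kernel_power \<Omega> P k x y * centred f y)"
    using assms kernel_op_kernel_power[OF finite_states, of "centred f", symmetric]
    by (simp add: centred_def kernel_op_def)
  also have "\<dots> = kernel_apply \<Omega> P k f x - (\<Sum>y\<in>\<Omega>. f y * \<mu> y)"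
    using one by (simp add: centred_def kernel_apply_def right_diff_distrib sum_subtractf
        sum_distrib_right[symmetric] mult.commute)
  finally show ?thesis by simp
qed

text \<open>
  A kernel preserves constants, so the error is \<open>1 / M\<close> times the sum of the iterates of the
  centred function.
\<close>

theorem ergodic_average_L2_le:
  assumes gap: "\<And>g. g \<in> mean_zero \<Longrightarrow> ip g g \<le> C * dirichlet g" and C: "C > 0" and M: "M \<ge> 1"
  shows "(\<Sum>x\<in>\<Omega>. (1 / real M * (\<Sum>k=1..M. kernel_apply \<Omega> P k f x) - (\<Sum>y\<in>\<Omega>. f y * \<mu> y))\<^sup>2 * \<mu> x)
     \<le> ((1 + C) / real M)\<^sup>2 * (\<Sum>x\<in>\<Omega>. (f x)\<^sup>2 * \<mu> x)"
proof -
  let ?g = "centred f"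
  let ?S = "\<lambda>x. \<Sum>k=1..M. (A ^^ k) ?g x"
  have "(\<Sum>x\<in>\<Omega>. (1 / real M * (\<Sum>k=1..M. kernel_apply \<Omega> P k f x) - (\<Sum>y\<in>\<Omega>. f y * \<mu> y))\<^sup>2 * \<mu> x)
      = (\<Sum>x\<in>\<Omega>. (1 / real M)\<^sup>2 * (\<mu> x * ?S x * ?S x))"
  proof (rule sum.cong[OF refl])
    fix x assume x: "x \<in> \<Omega>"
    have "1 / real M * (\<Sum>k=1..M. kernel_apply \<Omega> P k f x) - (\<Sum>y\<in>\<Omega>. f y * \<mu> y) = 1 / real M * ?S x"
      using M by (simp add: kernel_apply_centred[OF x] sum.distrib add_divide_distrib)
    thus "(1 / real M * (\<Sum>k=1..M. kernel_apply \<Omega> P k f x) - (\<Sum>y\<in>\<Omega>. f y * \<mu> y))\<^sup>2 * \<mu> x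
        = (1 / real M)\<^sup>2 * (\<mu> x * ?S x * ?S x)"
      by (simp add: power2_eq_square)
  qed
  also have "\<dots> = (1 / real M)\<^sup>2 * ip ?S ?S" by (simp only: wip_def sum_distrib_left)
  also have "\<dots> \<le> (1 / real M)\<^sup>2 * ((1 + C)\<^sup>2 * (\<Sum>x\<in>\<Omega>. (f x)\<^sup>2 * \<mu> x))"
  proof -
    have "ip ?S ?S \<le> (1 + C)\<^sup>2 * ip ?g ?g" by (rule norm_ergodic_sum_le[OF gap C centred_mean_zero])
    also have "\<dots> \<le> (1 + C)\<^sup>2 * (\<Sum>x\<in>\<Omega>. (f x)\<^sup>2 * \<mu> x)"
      by (intro mult_left_mono ip_centred_le) simp
    finally show ?thesis by (intro mult_left_mono) simp_all
  qed
  finally show ?thesis by (simp add: power_divide)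
qed

text \<open>
  Under the stationary law the mean square of the sum over \<open>k = 1, \<dots>, M\<close> of the centred
  observations is the double sum of their correlations, which depend only on the time distance.
\<close>

theorem stationary_mean_square_error_le:
  assumes gap: "\<And>g. g \<in> mean_zero \<Longrightarrow> ip g g \<le> C * dirichlet g" and C: "C \<ge> 1 / 2" and M: "M \<ge> 1"
    and mc: "markov_chain S Y \<Omega> \<mu> P"
  shows "(\<integral>w. (1 / real M * (\<Sum>k=1..M. f (Y k w)) - (\<Sum>y\<in>\<Omega>. f y * \<mu> y))\<^sup>2 \<partial>S)
     \<le> 2 * C / real M * (\<Sum>x\<in>\<Omega>. (f x)\<^sup>2 * \<mu> x)"
proof -
  let ?g = "centred f"
  have g: "x \<notin> \<Omega> \<Longrightarrow> ?g x = 0" for x by (simp add: centred_def)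
  note val = markov_chain_state[OF mc]
  have "(\<integral>w. (1 / real M * (\<Sum>k=1..M. f (Y k w)) - (\<Sum>y\<in>\<Omega>. f y * \<mu> y))\<^sup>2 \<partial>S)
      = (\<integral>w. (1 / real M)\<^sup>2 * (\<Sum>k=1..M. \<Sum>l=1..M. ?g (Y k w) * ?g (Y l w)) \<partial>S)"
  proof (rule Bochner_Integration.integral_cong[OF refl])
    fix w assume w: "w \<in> space S"
    have "f (Y k w) = ?g (Y k w) + (\<Sum>y\<in>\<Omega>. f y * \<mu> y)" if "k \<in> {1..M}" for k
      using val[of k w] w that by (simp add: centred_def)
    hence "1 / real M * (\<Sum>k=1..M. f (Y k w)) - (\<Sum>y\<in>\<Omega>. f y * \<mu> y) = 1 / real M * (\<Sum>k=1..M. ?g (Y k w))"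
      using M by (simp add: sum.distrib add_divide_distrib)
    thus "(1 / real M * (\<Sum>k=1..M. f (Y k w)) - (\<Sum>y\<in>\<Omega>. f y * \<mu> y))\<^sup>2
        = (1 / real M)\<^sup>2 * (\<Sum>k=1..M. \<Sum>l=1..M. ?g (Y k w) * ?g (Y l w))"
      by (simp add: power_mult_distrib power_divide power2_eq_square[of "sum _ _"] sum_product)
  qed
  also have "\<dots> = (1 / real M)\<^sup>2 * (\<Sum>k=1..M. \<Sum>l=1..M. (\<integral>w. ?g (Y k w) * ?g (Y l w) \<partial>S))"
  proof -
    have int: "integrable S (\<lambda>w. ?g (Y k w) * ?g (Y l w))" if "k \<in> {1..M}" "l \<in> {1..M}" for k l
      using that by (intro expectation_product(1)[OF mc]) (auto simp: g)
    have "(\<integral>w. (\<Sum>k=1..M. \<Sum>l=1..M. ?g (Y k w) * ?g (Y l w)) \<partial>S)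
        = (\<Sum>k=1..M. (\<integral>w. (\<Sum>l=1..M. ?g (Y k w) * ?g (Y l w)) \<partial>S))"
      by (intro Bochner_Integration.integral_sum Bochner_Integration.integrable_sum int)
    also have "\<dots> = (\<Sum>k=1..M. \<Sum>l=1..M. (\<integral>w. ?g (Y k w) * ?g (Y l w) \<partial>S))"
      by (intro sum.cong refl Bochner_Integration.integral_sum int)
    finally show ?thesis by simp
  qed
  also have "\<dots> = (1 / real M)\<^sup>2 * (\<Sum>k=1..M. \<Sum>l=1..M. ip ?g ((A ^^ ((k - l) + (l - k))) ?g))"
  proof -
    have "(\<integral>w. ?g (Y k w) * ?g (Y l w) \<partial>S) = ip ?g ((A ^^ ((k - l) + (l - k))) ?g)"
      if "k \<in> {1..M}" "l \<in> {1..M}" for k l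
      using that by (intro expectation_product(2)[OF mc]) (auto simp: g)
    thus ?thesis by simp
  qed
  also have "\<dots> \<le> (1 / real M)\<^sup>2 * (real M * (2 * C) * ip ?g ?g)"
    by (intro mult_left_mono sum_correlations_le[OF gap C centred_mean_zero]) simp_all
  also have "\<dots> \<le> (1 / real M)\<^sup>2 * (real M * (2 * C) * (\<Sum>x\<in>\<Omega>. (f x)\<^sup>2 * \<mu> x))"
    using C by (intro mult_left_mono ip_centred_le) simp_all
  also have "\<dots> = 2 * C / real M * (\<Sum>x\<in>\<Omega>. (f x)\<^sup>2 * \<mu> x)"
    using M by (simp add: power2_eq_square)
  finally show ?thesis .
qed

end

section \<open>Dobrushin's criterion for the heat bath\<close>

abbreviation flip_site :: "nat \<Rightarrow> (nat \<Rightarrow> int) \<Rightarrow> nat \<Rightarrow> int" where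
  "flip_site i \<sigma> \<equiv> flip_spins {i} \<sigma>"

text \<open>
  The probability that resampling the spin at site \<open>i\<close>, conditioned on all other spins, changes
  it.
\<close>

definition heat_bath_rate :: "((nat \<Rightarrow> int) \<Rightarrow> real) \<Rightarrow> nat \<Rightarrow> (nat \<Rightarrow> int) \<Rightarrow> real" where
  "heat_bath_rate \<mu> i \<sigma> = \<mu> (flip_site i \<sigma>) / (\<mu> \<sigma> + \<mu> (flip_site i \<sigma>))"

text \<open>
  The Dirichlet form of the heat-bath dynamics in which every site is resampled at rate \<open>1\<close>.
\<close>

definition heat_bath_form :: "nat \<Rightarrow> ((nat \<Rightarrow> int) \<Rightarrow> real) \<Rightarrow> ((nat \<Rightarrow> int) \<Rightarrow> real) \<Rightarrow> real" where
  "heat_bath_form N \<mu> g = (\<Sum>\<sigma>\<in>spin_space N. \<Sum>i=1..N.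
     \<mu> \<sigma> * heat_bath_rate \<mu> i \<sigma> * (g \<sigma> - g (flip_site i \<sigma>))\<^sup>2) / 2"

lemma finite_spin_space [simp]: "finite (spin_space N)"
  unfolding spin_space_def by (intro finite_PiE) auto

lemma spin_values: "\<sigma> \<in> spin_space N \<Longrightarrow> i \<in> {1..N} \<Longrightarrow> \<sigma> i = -1 \<or> \<sigma> i = 1"
  using PiE_mem[of \<sigma> "{1..N}" "\<lambda>_. {-1, 1}" i] by (simp add: spin_space_def)

lemma flip_spins_in_spin_space:
  assumes "\<sigma> \<in> spin_space N" "C \<subseteq> {1..N}"
  shows "flip_spins C \<sigma> \<in> spin_space N"
  unfolding spin_space_def
proof (rule PiE_I)
  fix i assume "i \<in> {1..N}"
  from spin_values[OF assms(1) this] show "flip_spins C \<sigma> i \<in> {-1, 1}"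
    by (auto simp: flip_spins_def)
next
  fix i assume i: "i \<notin> {1..N}"
  hence "i \<notin> C" using assms(2) by blast
  moreover have "\<sigma> i = undefined"
    using PiE_arb[OF _ i] assms(1) unfolding spin_space_def by blast
  ultimately show "flip_spins C \<sigma> i = undefined" by (simp add: flip_spins_def)
qed

lemma flip_spins_involution [simp]: "flip_spins C (flip_spins C \<sigma>) = \<sigma>"
  by (auto simp: flip_spins_def fun_eq_iff)

lemma flip_spins_commute: "flip_spins C (flip_spins D \<sigma>) = flip_spins D (flip_spins C \<sigma>)"
  by (auto simp: flip_spins_def fun_eq_iff)

lemma sum_flip_site:
  assumes "i \<in> {1..N}"
  shows "(\<Sum>\<sigma>\<in>spin_space N. F (flip_site i \<sigma>)) = (\<Sum>\<sigma>\<in>spin_space N. F \<sigma>)"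
  by (rule sum.reindex_bij_witness[of _ "flip_site i" "flip_site i"])
     (use assms in \<open>auto intro: flip_spins_in_spin_space\<close>)

lemma flip_invariant_imp_constant:
  assumes inv: "\<And>\<sigma> j. \<sigma> \<in> spin_space N \<Longrightarrow> j \<in> {1..N} \<Longrightarrow> h (flip_site j \<sigma>) = h \<sigma>"
    and "\<sigma> \<in> spin_space N" "\<eta> \<in> spin_space N"
  shows "h \<sigma> = h \<eta>"
proof -
  have flips: "h (flip_spins C \<sigma>) = h \<sigma>" if "finite C" "C \<subseteq> {1..N}" for C
    using that
  proof (induction C)
    case empty
    thus ?case by (simp add: flip_spins_def)
  next
    case (insert j C)
    have "flip_spins (insert j C) \<sigma> = flip_site j (flip_spins C \<sigma>)"
      using insert.hyps by (auto simp: flip_spins_def fun_eq_iff)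
    thus ?case using insert inv[of "flip_spins C \<sigma>" j] flip_spins_in_spin_space[OF assms(2), of C]
      by simp
  qed
  let ?C = "{i \<in> {1..N}. \<eta> i \<noteq> \<sigma> i}"
  have "\<eta> = flip_spins ?C \<sigma>"
  proof
    fix i
    show "\<eta> i = flip_spins ?C \<sigma> i"
    proof (cases "i \<in> {1..N}")
      case True
      thus ?thesis using spin_values[OF assms(2) True] spin_values[OF assms(3) True]
        by (auto simp: flip_spins_def)
    next
      case False
      hence "\<sigma> i = undefined" "\<eta> i = undefined"
        using PiE_arb[OF _ False] assms(2,3) unfolding spin_space_def by blast+
      thus ?thesis by (simp add: flip_spins_def)
    qed
  qed
  moreover have "h (flip_spins ?C \<sigma>) = h \<sigma>" by (rule flips) auto
  ultimately show ?thesis by (simp only:)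
qed

text \<open>
  Dobrushin's contraction argument. Let \<open>h\<close> be the eigenfunction of the heat-bath generator whose
  eigenvalue \<open>\<theta>\<close> is largest among those of mean-zero eigenfunctions, and let \<open>osc j\<close> be the largest
  change of \<open>h\<close> under a flip at \<open>j\<close>. Compare the eigenvalue equation at a configuration where
  \<open>osc j\<close> is attained with the one at the flipped configuration. Resampling \<open>j\<close> itself removes the
  discrepancy; resampling \<open>i \<noteq> j\<close> cannot enlarge it, except that the two configurations resample
  \<open>i\<close> with different probabilities, which costs at most \<open>c i j * osc i\<close>. Summation over \<open>j\<close>
  gives \<open>\<theta> \<le> t - 1\<close>, because a nonzero \<open>h\<close> with mean zero has positive total oscillation.
\<close>

lemma dobrushin_spectral_gap:
  fixes \<mu> :: "(nat \<Rightarrow> int) \<Rightarrow> real" and c :: "nat \<Rightarrow> nat \<Rightarrow> real"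
  assumes pos: "\<And>\<sigma>. \<sigma> \<in> spin_space N \<Longrightarrow> \<mu> \<sigma> > 0"
    and influence: "\<And>i j \<sigma>. i \<in> {1..N} \<Longrightarrow> j \<in> {1..N} \<Longrightarrow> i \<noteq> j \<Longrightarrow> \<sigma> \<in> spin_space N \<Longrightarrow>
      \<bar>heat_bath_rate \<mu> i \<sigma> - heat_bath_rate \<mu> i (flip_site j \<sigma>)\<bar> \<le> c i j"
    and total: "\<And>i. i \<in> {1..N} \<Longrightarrow> (\<Sum>j\<in>{1..N}-{i}. c i j) \<le> t"
    and g: "g \<in> weighted_space.mean_zero (spin_space N) \<mu>"
  shows "(1 - t) * wip (spin_space N) \<mu> g g \<le> heat_bath_form N \<mu> g"
proof (cases "g = (\<lambda>_. 0)")
  case True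
  thus ?thesis by (simp add: wip_def heat_bath_form_def)
next
  case False
  interpret weighted_space "spin_space N" \<mu> by unfold_locales (auto intro: pos)
  let ?O = "spin_space N" and ?r = "heat_bath_rate \<mu>"
  \<comment> \<open>the heat-bath generator, as a matrix\<close>
  define K where "K \<sigma> \<eta> = (\<Sum>i=1..N. ?r i \<sigma> * ((if \<eta> = flip_site i \<sigma> then 1 else 0) - (if \<eta> = \<sigma> then 1 else 0)))"
    for \<sigma> \<eta>
  have flipO: "flip_site i \<sigma> \<in> ?O" if "\<sigma> \<in> ?O" "i \<in> {1..N}" for i \<sigma>
    using that by (intro flip_spins_in_spin_space) auto
  have r_sum: "?r i \<sigma> + ?r i (flip_site i \<sigma>) = 1" if "\<sigma> \<in> ?O" "i \<in> {1..N}" for i \<sigma>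
    using pos[OF that(1)] pos[OF flipO[OF that]]
    by (simp add: heat_bath_rate_def add.commute[of "\<mu> (flip_site i \<sigma>)"] add_divide_distrib[symmetric])
  have r_nonneg: "?r i \<sigma> \<ge> 0" if "\<sigma> \<in> ?O" "i \<in> {1..N}" for i \<sigma>
    using pos[OF that(1)] pos[OF flipO[OF that]] by (simp add: heat_bath_rate_def)
  have r_sym: "\<mu> \<sigma> * ?r i \<sigma> = \<mu> (flip_site i \<sigma>) * ?r i (flip_site i \<sigma>)" for i \<sigma>
    by (simp add: heat_bath_rate_def add.commute)
  have Kop: "kernel_op ?O K f \<sigma> = (\<Sum>i=1..N. ?r i \<sigma> * (f (flip_site i \<sigma>) - f \<sigma>))" if "\<sigma> \<in> ?O" for f \<sigma>
  proof -
    have "kernel_op ?O K f \<sigma> = (\<Sum>\<eta>\<in>?O. \<Sum>i=1..N. ?r i \<sigma> *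
        ((if \<eta> = flip_site i \<sigma> then f \<eta> else 0) - (if \<eta> = \<sigma> then f \<eta> else 0)))"
      using that unfolding kernel_op_def K_def
      by (auto simp: sum_distrib_right intro!: sum.cong)
    also have "\<dots> = (\<Sum>i=1..N. \<Sum>\<eta>\<in>?O. ?r i \<sigma> *
        ((if \<eta> = flip_site i \<sigma> then f \<eta> else 0) - (if \<eta> = \<sigma> then f \<eta> else 0)))" by (rule sum.swap)
    also have "\<dots> = (\<Sum>i=1..N. ?r i \<sigma> * (f (flip_site i \<sigma>) - f \<sigma>))"
      using that flipO by (simp add: sum_distrib_left[symmetric] sum_subtractf)
    finally show ?thesis .
  qed
  have symK: "\<mu> \<sigma> * K \<sigma> \<eta> = \<mu> \<eta> * K \<eta> \<sigma>" if "\<sigma> \<in> ?O" "\<eta> \<in> ?O" for \<sigma> \<eta>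
    unfolding K_def sum_distrib_left
  proof (intro sum.cong refl)
    fix i
    have "\<sigma> = flip_site i \<eta> \<longleftrightarrow> \<eta> = flip_site i \<sigma>" by auto
    thus "\<mu> \<sigma> * (?r i \<sigma> * ((if \<eta> = flip_site i \<sigma> then 1 else 0) - (if \<eta> = \<sigma> then 1 else 0)))
        = \<mu> \<eta> * (?r i \<eta> * ((if \<sigma> = flip_site i \<eta> then 1 else 0) - (if \<sigma> = \<eta> then 1 else 0)))"
      using r_sym[of \<sigma> i] by auto
  qed
  have Kinv: "kernel_op ?O K f \<in> mean_zero" if "f \<in> mean_zero" for f
  proof -
    have "wip ?O \<mu> (kernel_op ?O K f) (\<lambda>_. 1) = wip ?O \<mu> f (kernel_op ?O K (\<lambda>_. 1))"
      by (rule kernel_op_selfadjoint[OF symK])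
    also have "\<dots> = 0" unfolding wip_def by (simp add: Kop)
    finally show ?thesis by (simp add: mean_zero_def wip_def) (simp add: kernel_op_def)
  qed
  have form: "wip ?O \<mu> f (kernel_op ?O K f) = - heat_bath_form N \<mu> f" for f
  proof -
    have half: "(\<Sum>\<sigma>\<in>?O. \<mu> \<sigma> * ?r i \<sigma> * (f \<sigma> * (f (flip_site i \<sigma>) - f \<sigma>)))
        = - (\<Sum>\<sigma>\<in>?O. \<mu> \<sigma> * ?r i \<sigma> * (f \<sigma> - f (flip_site i \<sigma>))\<^sup>2) / 2" if "i \<in> {1..N}" for i
    proof -
      let ?F = "\<lambda>\<sigma>. \<mu> \<sigma> * ?r i \<sigma> * (f \<sigma> * (f (flip_site i \<sigma>) - f \<sigma>))"
      have "(\<Sum>\<sigma>\<in>?O. ?F \<sigma>) + (\<Sum>\<sigma>\<in>?O. ?F \<sigma>) = (\<Sum>\<sigma>\<in>?O. ?F \<sigma> + ?F (flip_site i \<sigma>))"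
        by (simp add: sum.distrib sum_flip_site[OF that, of ?F, symmetric])
      also have "\<dots> = (\<Sum>\<sigma>\<in>?O. - (\<mu> \<sigma> * ?r i \<sigma> * (f \<sigma> - f (flip_site i \<sigma>))\<^sup>2))"
        by (intro sum.cong refl)
           (simp add: r_sym[symmetric] power2_eq_square algebra_simps)
      finally show ?thesis by (simp add: sum_negf)
    qed
    have "wip ?O \<mu> f (kernel_op ?O K f) = (\<Sum>\<sigma>\<in>?O. \<Sum>i=1..N. \<mu> \<sigma> * ?r i \<sigma> * (f \<sigma> * (f (flip_site i \<sigma>) - f \<sigma>)))"
      unfolding wip_def by (intro sum.cong refl) (simp add: Kop sum_distrib_left mult_ac)
    also have "\<dots> = (\<Sum>i=1..N. \<Sum>\<sigma>\<in>?O. \<mu> \<sigma> * ?r i \<sigma> * (f \<sigma> * (f (flip_site i \<sigma>) - f \<sigma>)))"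
      by (rule sum.swap)
    also have "\<dots> = - (\<Sum>i=1..N. \<Sum>\<sigma>\<in>?O. \<mu> \<sigma> * ?r i \<sigma> * (f \<sigma> - f (flip_site i \<sigma>))\<^sup>2) / 2"
      by (simp add: half sum_negf sum_divide_distrib[symmetric])
    also have "\<dots> = - heat_bath_form N \<mu> f"
      unfolding heat_bath_form_def by (subst sum.swap) simp
    finally show ?thesis .
  qed
  obtain h \<theta> where h: "h \<in> mean_zero" "h \<noteq> (\<lambda>_. 0)" "kernel_op ?O K h = (\<lambda>x. \<theta> * h x)"
    and max: "\<And>f. f \<in> mean_zero \<Longrightarrow> wip ?O \<mu> f (kernel_op ?O K f) \<le> \<theta> * wip ?O \<mu> f f"
    using rayleigh_maximiser_is_eigenvector[OF subspace_mean_zero g False symK Kinv] by blast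
  define osc where "osc j = Max ((\<lambda>\<sigma>. \<bar>h \<sigma> - h (flip_site j \<sigma>)\<bar>) ` ?O)" for j
  have osc: "\<bar>h \<sigma> - h (flip_site j \<sigma>)\<bar> \<le> osc j" if "\<sigma> \<in> ?O" for \<sigma> j
    unfolding osc_def using that by (intro Max_ge) auto
  have ne: "?O \<noteq> {}" using h by (auto simp: mean_zero_def)
  have osc_nonneg: "osc j \<ge> 0" for j
    using ne osc[of _ j] abs_ge_zero by (meson all_not_in_conv order_trans)
  have attained: "\<exists>\<sigma>\<in>?O. h \<sigma> - h (flip_site j \<sigma>) = osc j" if j: "j \<in> {1..N}" for j
  proof -
    have "osc j \<in> (\<lambda>\<sigma>. \<bar>h \<sigma> - h (flip_site j \<sigma>)\<bar>) ` ?O"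
      unfolding osc_def using ne by (intro Max_in) auto
    then obtain \<sigma> where \<sigma>: "\<sigma> \<in> ?O" "osc j = \<bar>h \<sigma> - h (flip_site j \<sigma>)\<bar>" by auto
    show ?thesis
    proof (cases "h \<sigma> - h (flip_site j \<sigma>) \<ge> 0")
      case True thus ?thesis using \<sigma> by auto
    next
      case False thus ?thesis using \<sigma> flipO[OF \<sigma>(1) j] by (intro bexI[of _ "flip_site j \<sigma>"]) auto
    qed
  qed
  have key: "\<theta> * osc j \<le> - osc j + (\<Sum>i\<in>{1..N}-{j}. c i j * osc i)" if j: "j \<in> {1..N}" for j
  proof -
    obtain \<sigma> where \<sigma>: "\<sigma> \<in> ?O" and max\<sigma>: "h \<sigma> - h (flip_site j \<sigma>) = osc j" using attained[OF j] by blast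
    let ?s = "flip_site j \<sigma>"
    let ?t = "\<lambda>i. ?r i \<sigma> * (h (flip_site i \<sigma>) - h \<sigma>) - ?r i ?s * (h (flip_site i ?s) - h ?s)"
    have "\<theta> * osc j = kernel_op ?O K h \<sigma> - kernel_op ?O K h ?s"
      unfolding h(3) max\<sigma>[symmetric] by (simp add: right_diff_distrib)
    also have "\<dots> = (\<Sum>i=1..N. ?t i)" using \<sigma> flipO[OF \<sigma> j] by (simp add: Kop sum_subtractf)
    also have "(\<Sum>i=1..N. ?t i) = ?t j + (\<Sum>i\<in>{1..N}-{j}. ?t i)" using j by (intro sum.remove) auto
    finally have total: "\<theta> * osc j = ?t j + (\<Sum>i\<in>{1..N}-{j}. ?t i)" .
    \<comment> \<open>The rates at \<open>\<sigma>\<close> and at the flipped configuration add up to \<open>1\<close>.\<close>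
    have own: "?t j = - osc j"
    proof -
      have "?t j = - (?r j \<sigma> + ?r j ?s) * osc j"
        unfolding max\<sigma>[symmetric] by (simp add: algebra_simps)
      thus ?thesis using r_sum[OF \<sigma> j] by simp
    qed
    have others: "(\<Sum>i\<in>{1..N}-{j}. ?t i) \<le> (\<Sum>i\<in>{1..N}-{j}. c i j * osc i)"
    proof (rule sum_mono)
      fix i assume i: "i \<in> {1..N} - {j}"
      have iO: "flip_site i \<sigma> \<in> ?O" and sO: "?s \<in> ?O" using flipO \<sigma> i j by auto
      have comm: "flip_site j (flip_site i \<sigma>) = flip_site i ?s" by (rule flip_spins_commute)
      have split: "?t i = ?r i \<sigma> * ((h (flip_site i \<sigma>) - h (flip_site i ?s)) - (h \<sigma> - h ?s))
          + (?r i \<sigma> - ?r i ?s) * (h (flip_site i ?s) - h ?s)"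
        by (simp add: algebra_simps)
      have "h (flip_site i \<sigma>) - h (flip_site i ?s) \<le> osc j"
        using osc[OF iO, of j] unfolding comm by linarith
      hence first: "?r i \<sigma> * ((h (flip_site i \<sigma>) - h (flip_site i ?s)) - (h \<sigma> - h ?s)) \<le> 0"
        using r_nonneg[OF \<sigma>, of i] i unfolding max\<sigma> by (intro mult_nonneg_nonpos) auto
      have "(?r i \<sigma> - ?r i ?s) * (h (flip_site i ?s) - h ?s)
          \<le> \<bar>?r i \<sigma> - ?r i ?s\<bar> * \<bar>h ?s - h (flip_site i ?s)\<bar>"
        unfolding abs_minus_commute[of "h ?s"] abs_mult[symmetric] by (rule abs_ge_self)
      also have "\<bar>?r i \<sigma> - ?r i ?s\<bar> * \<bar>h ?s - h (flip_site i ?s)\<bar> \<le> c i j * osc i"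
      proof (rule mult_mono)
        show infl: "\<bar>?r i \<sigma> - ?r i ?s\<bar> \<le> c i j" using i j by (intro influence \<sigma>) auto
        show "\<bar>h ?s - h (flip_site i ?s)\<bar> \<le> osc i" by (rule osc[OF sO])
        show "0 \<le> c i j" using infl abs_ge_zero by (rule order_trans[rotated])
      qed simp
      finally have second: "(?r i \<sigma> - ?r i ?s) * (h (flip_site i ?s) - h ?s) \<le> c i j * osc i" .
      from add_mono[OF first second] show "?t i \<le> c i j * osc i"
        unfolding split by (simp only: add_0)
    qed
    show ?thesis unfolding total own by (rule add_left_mono[OF others])
  qed
  let ?D = "\<Sum>j=1..N. osc j"
  have "\<theta> * ?D \<le> (\<Sum>j=1..N. - osc j + (\<Sum>i\<in>{1..N}-{j}. c i j * osc i))"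
    unfolding sum_distrib_left by (intro sum_mono key)
  also have "\<dots> = - ?D + (\<Sum>j=1..N. \<Sum>i\<in>{1..N}-{j}. c i j * osc i)"
    by (simp add: sum.distrib sum_subtractf)
  also have "(\<Sum>j=1..N. \<Sum>i\<in>{1..N}-{j}. c i j * osc i) = (\<Sum>i=1..N. \<Sum>j\<in>{1..N}-{i}. c i j * osc i)"
  proof -
    have "(\<Sum>j=1..N. \<Sum>i\<in>{1..N}-{j}. c i j * osc i)
        = (\<Sum>j=1..N. \<Sum>i=1..N. if i \<noteq> j then c i j * osc i else 0)"
      by (rule sum.cong[OF refl], rule sum.mono_neutral_cong_left) auto
    also have "\<dots> = (\<Sum>i=1..N. \<Sum>j=1..N. if i \<noteq> j then c i j * osc i else 0)" by (rule sum.swap)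
    also have "\<dots> = (\<Sum>i=1..N. \<Sum>j\<in>{1..N}-{i}. c i j * osc i)"
      by (rule sum.cong[OF refl], rule sum.mono_neutral_cong_right) auto
    finally show ?thesis .
  qed
  also have "\<dots> \<le> (\<Sum>i=1..N. t * osc i)"
    unfolding sum_distrib_right[symmetric] by (intro sum_mono mult_right_mono total osc_nonneg)
  also have "(\<Sum>i=1..N. t * osc i) = t * ?D" by (simp only: sum_distrib_left)
  finally have "\<theta> * ?D \<le> (t - 1) * ?D" by (simp only: left_diff_distrib) simp
  moreover have "?D > 0"
  proof (rule ccontr)
    assume "\<not> ?D > 0"
    hence "?D = 0" using osc_nonneg by (meson linorder_not_le order_antisym sum_nonneg not_less)
    hence zero: "osc j = 0" if "j \<in> {1..N}" for j
      using osc_nonneg that by (simp add: sum_nonneg_eq_0_iff)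
    have const: "h \<sigma> = h \<eta>" if "\<sigma> \<in> ?O" "\<eta> \<in> ?O" for \<sigma> \<eta>
    proof (rule flip_invariant_imp_constant[OF _ that])
      fix \<sigma> j assume "\<sigma> \<in> ?O" "j \<in> {1..N}"
      thus "h (flip_site j \<sigma>) = h \<sigma>" using osc[of \<sigma> j] zero[of j] by simp
    qed
    obtain \<sigma> where \<sigma>: "\<sigma> \<in> ?O" using ne by blast
    have "0 = (\<Sum>\<eta>\<in>?O. \<mu> \<eta> * h \<eta>)" using h(1) by (simp add: mean_zero_def)
    also have "\<dots> = (\<Sum>\<eta>\<in>?O. \<mu> \<eta>) * h \<sigma>"
      unfolding sum_distrib_right by (intro sum.cong refl) (simp add: const[OF _ \<sigma>])
    finally have "h \<sigma> = 0" using sum_pos[of ?O \<mu>] pos ne by simp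
    hence "h = (\<lambda>_. 0)" using const[OF _ \<sigma>] h(1) by (auto simp: mean_zero_def fun_eq_iff)
    with h(2) show False by contradiction
  qed
  ultimately have "\<theta> \<le> t - 1" by (simp only: mult_le_cancel_right)
  hence "\<theta> * wip ?O \<mu> g g \<le> (t - 1) * wip ?O \<mu> g g" by (intro mult_right_mono wip_self_nonneg)
  thus ?thesis using max[OF g] form[of g] by (simp add: algebra_simps)
qed

section \<open>The heat bath of the Ising model on a cycle\<close>

definition cyc_pred :: "nat \<Rightarrow> nat \<Rightarrow> nat" where
  "cyc_pred N i = (if i = 1 then N else i - 1)"

lemma cyc_succ_in: "i \<in> {1..N} \<Longrightarrow> cyc_succ N i \<in> {1..N}"
  by (auto simp: cyc_succ_def)

lemma cyc_pred_in: "i \<in> {1..N} \<Longrightarrow> cyc_pred N i \<in> {1..N}"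
  by (auto simp: cyc_pred_def)

lemma cyc_succ_pred: "i \<in> {1..N} \<Longrightarrow> cyc_succ N (cyc_pred N i) = i"
  by (auto simp: cyc_pred_def cyc_succ_def)

lemma cyc_pred_succ: "i \<in> {1..N} \<Longrightarrow> cyc_pred N (cyc_succ N i) = i"
  by (auto simp: cyc_pred_def cyc_succ_def)

lemma cyc_succ_neq: "N \<ge> 2 \<Longrightarrow> i \<in> {1..N} \<Longrightarrow> cyc_succ N i \<noteq> i"
  by (auto simp: cyc_succ_def)

lemma cyc_pred_neq: "N \<ge> 2 \<Longrightarrow> i \<in> {1..N} \<Longrightarrow> cyc_pred N i \<noteq> i"
  by (auto simp: cyc_pred_def)

lemma spin_space_nonempty: "spin_space N \<noteq> {}"
  unfolding spin_space_def by (simp add: PiE_eq_empty_iff)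

lemma partition_function_pos: "partition_function N J > 0"
  unfolding partition_function_def gibbs_weight_def
  by (intro sum_pos finite_spin_space spin_space_nonempty) simp

lemma gibbs_pos: "gibbs N J \<sigma> > 0"
  unfolding gibbs_def using partition_function_pos by (simp add: gibbs_weight_def)

lemma gibbs_sum: "(\<Sum>\<sigma>\<in>spin_space N. gibbs N J \<sigma>) = 1"
  unfolding gibbs_def sum_divide_distrib[symmetric] partition_function_def[symmetric]
  using partition_function_pos[of N J] by simp

text \<open>
  The energy of the two edges at \<open>i\<close>, as a function of the spin at \<open>i\<close>. On the cycle with two
  sites both edges join the same pair, and the other spin is counted twice, as it should be.
\<close>

definition local_alignment :: "nat \<Rightarrow> (nat \<Rightarrow> int) \<Rightarrow> nat \<Rightarrow> real" where
  "local_alignment N \<sigma> i = real_of_int (\<sigma> i * (\<sigma> (cyc_pred N i) + \<sigma> (cyc_succ N i)))"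

text \<open>
  A flip at \<open>i\<close> reverses the sign of the two edge terms at \<open>i\<close> and leaves the others alone. For
  \<open>N = 1\<close> the only edge is a loop, whose energy does not change, so this case is excluded.
\<close>

lemma gibbs_weight_flip_site:
  assumes N: "N \<ge> 2" and i: "i \<in> {1..N}"
  shows "gibbs_weight N J \<sigma> = gibbs_weight N J (flip_site i \<sigma>) * exp (2 * J * local_alignment N \<sigma> i)"
proof -
  let ?s = "flip_site i \<sigma>" and ?p = "cyc_pred N i"
  let ?d = "\<lambda>e. real_of_int (\<sigma> e * \<sigma> (cyc_succ N e)) - real_of_int (?s e * ?s (cyc_succ N e))"
  have "(\<Sum>e=1..N. ?d e) = (\<Sum>e\<in>{i, ?p}. ?d e)"
  proof (rule sum.mono_neutral_right)
    show "{i, ?p} \<subseteq> {1..N}" using i cyc_pred_in[OF i] by simp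
    show "\<forall>e\<in>{1..N} - {i, ?p}. ?d e = 0"
    proof
      fix e assume e: "e \<in> {1..N} - {i, ?p}"
      hence "cyc_succ N e \<noteq> i" using cyc_pred_succ[of e N] by auto
      thus "?d e = 0" using e by (simp add: flip_spins_def)
    qed
  qed simp
  also have "\<dots> = ?d i + ?d ?p" using cyc_pred_neq[OF N i] by simp
  also have "\<dots> = 2 * local_alignment N \<sigma> i"
    using cyc_pred_neq[OF N i] cyc_succ_neq[OF N i]
    by (simp add: flip_spins_def local_alignment_def cyc_succ_pred[OF i] algebra_simps)
  finally have "(\<Sum>e=1..N. real_of_int (\<sigma> e * \<sigma> (cyc_succ N e)))
      = (\<Sum>e=1..N. real_of_int (?s e * ?s (cyc_succ N e))) + 2 * local_alignment N \<sigma> i"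
    by (simp add: sum_subtractf)
  thus ?thesis unfolding gibbs_weight_def exp_add[symmetric]
    by (simp only: distrib_left) (simp add: mult_ac)
qed

lemma heat_bath_rate_gibbs:
  assumes "N \<ge> 2" "i \<in> {1..N}"
  shows "heat_bath_rate (gibbs N J) i \<sigma> = 1 / (1 + exp (2 * J * local_alignment N \<sigma> i))"
proof -
  define v where "v = gibbs_weight N J (flip_site i \<sigma>)"
  have v: "v > 0" by (simp add: v_def gibbs_weight_def)
  have "heat_bath_rate (gibbs N J) i \<sigma> = v / (gibbs_weight N J \<sigma> + v)"
    unfolding heat_bath_rate_def gibbs_def v_def add_divide_distrib[symmetric]
    using partition_function_pos[of N J] by simp
  also have "gibbs_weight N J \<sigma> + v = v * (1 + exp (2 * J * local_alignment N \<sigma> i))"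
    unfolding gibbs_weight_flip_site[OF assms, of J \<sigma>] v_def by (simp add: algebra_simps)
  finally show ?thesis using v by simp
qed

lemma tanh_double_eq: "tanh (2 * J) = (exp (4 * J) - 1) / (exp (4 * J) + 1)" for J :: real
proof -
  have "(1 - 1 / u) / (1 + 1 / u) = (u - 1) / (u + 1)" if "u > 0" for u :: real
    using that by (simp add: divide_simps)
  moreover have "exp (- 2 * (2 * J)) = 1 / exp (4 * J)" by (simp add: exp_minus inverse_eq_divide)
  ultimately show ?thesis unfolding tanh_real_altdef by (simp only: exp_gt_zero)
qed

lemma local_alignment_values:
  assumes "\<sigma> \<in> spin_space N" "i \<in> {1..N}"
  shows "local_alignment N \<sigma> i \<in> {-2, 0, 2}"
  using spin_values[OF assms] spin_values[OF assms(1) cyc_pred_in[OF assms(2)]]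
    spin_values[OF assms(1) cyc_succ_in[OF assms(2)]]
  unfolding local_alignment_def by auto

text \<open>
  The rate is a logistic function of the local alignment. Since the alignment takes only the values
  \<open>- 2\<close>, \<open>0\<close> and \<open>2\<close>, symmetrically around the inflection point, the rate is an affine function
  of it. This turns the influence of a neighbour into a linear quantity.
\<close>

lemma heat_bath_rate_gibbs_affine:
  assumes "N \<ge> 2" "i \<in> {1..N}" "\<sigma> \<in> spin_space N"
  shows "heat_bath_rate (gibbs N J) i \<sigma>
    = 1 / 2 - tanh (2 * J) / 4 * local_alignment N \<sigma> i"
proof -
  define u where "u = exp (4 * J)"
  have u: "u > 0" by (simp add: u_def)
  have u1: "u + 1 \<noteq> 0" using u by linarith
  have plus: "exp (2 * J * 2) = u" by (simp add: u_def)
  have minus: "exp (2 * J * - 2) = 1 / u" by (simp add: u_def exp_minus inverse_eq_divide)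
  consider "local_alignment N \<sigma> i = - 2" | "local_alignment N \<sigma> i = 0" | "local_alignment N \<sigma> i = 2"
    using local_alignment_values[OF assms(3,2)] by auto
  thus ?thesis
  proof cases
    case 1
    have "1 / (1 + 1 / u) = 1 / 2 - (u - 1) / (u + 1) / 4 * - 2" using u u1 by (simp add: divide_simps)
    thus ?thesis unfolding heat_bath_rate_gibbs[OF assms(1,2)] tanh_double_eq 1 minus u_def[symmetric] .
  next
    case 2
    thus ?thesis unfolding heat_bath_rate_gibbs[OF assms(1,2)] by simp
  next
    case 3
    have "1 / (1 + u) = 1 / 2 - (u - 1) / (u + 1) / 4 * 2" using u u1 by (simp add: divide_simps)
    thus ?thesis unfolding heat_bath_rate_gibbs[OF assms(1,2)] tanh_double_eq 3 plus u_def[symmetric] .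
  qed
qed

text \<open>
  Only the two neighbours of \<open>i\<close> matter, and flipping one of them changes the local alignment by
  \<open>2\<close>. If both neighbours are the same site (\<open>N = 2\<close>), both indicators count.
\<close>

lemma gibbs_influence:
  assumes J: "J \<ge> 0" and N: "N \<ge> 2" and ij: "i \<in> {1..N}" "j \<in> {1..N}" "i \<noteq> j"
    and \<sigma>: "\<sigma> \<in> spin_space N"
  shows "\<bar>heat_bath_rate (gibbs N J) i \<sigma> - heat_bath_rate (gibbs N J) i (flip_site j \<sigma>)\<bar>
    \<le> tanh (2 * J) / 2 *
        ((if j = cyc_succ N i then 1 else 0) + (if j = cyc_pred N i then 1 else 0))"
proof -
  let ?t = "tanh (2 * J)"
  let ?b = "(if j = cyc_succ N i then 1 else 0) + (if j = cyc_pred N i then 1 else 0) :: real"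
  have t: "?t \<ge> 0" using J by simp
  have \<sigma>': "flip_site j \<sigma> \<in> spin_space N" using ij \<sigma> by (intro flip_spins_in_spin_space) auto
  have "\<bar>local_alignment N (flip_site j \<sigma>) i - local_alignment N \<sigma> i\<bar> \<le> 2 * ?b"
    using spin_values[OF \<sigma> ij(1)] spin_values[OF \<sigma> cyc_pred_in[OF ij(1)]]
      spin_values[OF \<sigma> cyc_succ_in[OF ij(1)]] ij(3)
    unfolding local_alignment_def flip_spins_def by auto
  hence "?t / 4 * \<bar>local_alignment N (flip_site j \<sigma>) i - local_alignment N \<sigma> i\<bar> \<le> ?t / 4 * (2 * ?b)"
    by (rule mult_left_mono[OF _ divide_nonneg_pos[OF t]]) simp
  also have "?t / 4 * (2 * ?b) = ?t / 2 * ?b" by simp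
  also have "?t / 4 * \<bar>local_alignment N (flip_site j \<sigma>) i - local_alignment N \<sigma> i\<bar>
      = \<bar>?t / 4 * (local_alignment N (flip_site j \<sigma>) i - local_alignment N \<sigma> i)\<bar>"
    using t by (simp add: abs_mult)
  also have "?t / 4 * (local_alignment N (flip_site j \<sigma>) i - local_alignment N \<sigma> i)
      = heat_bath_rate (gibbs N J) i \<sigma> - heat_bath_rate (gibbs N J) i (flip_site j \<sigma>)"
    unfolding heat_bath_rate_gibbs_affine[OF N ij(1) \<sigma>] heat_bath_rate_gibbs_affine[OF N ij(1) \<sigma>']
    by (simp only: right_diff_distrib)
  finally show ?thesis .
qed

text \<open>
  Each spin is influenced by two neighbours, each with strength \<open>tanh (2 * J) / 2\<close>, so the
  total influence is \<open>tanh (2 * J) < 1\<close>, and \<open>1 - tanh (2 * J) = 2 / (exp (4 * J) + 1)\<close>.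
\<close>

lemma heat_bath_ising_gap:
  assumes J: "J \<ge> 0" and g: "g \<in> weighted_space.mean_zero (spin_space N) (gibbs N J)"
  shows "2 / (exp (4 * J) + 1) * wip (spin_space N) (gibbs N J) g g \<le> heat_bath_form N (gibbs N J) g"
proof -
  let ?t = "tanh (2 * J)"
  let ?c = "\<lambda>i j. ?t / 2 * ((if j = cyc_succ N i then 1 else 0) + (if j = cyc_pred N i then 1 else 0))"
  have t: "?t \<ge> 0" using J by simp
  have "(1 - ?t) * wip (spin_space N) (gibbs N J) g g \<le> heat_bath_form N (gibbs N J) g"
  proof (rule dobrushin_spectral_gap[OF gibbs_pos _ _ g])
    fix i j \<sigma> assume ij: "i \<in> {1..N}" "j \<in> {1..N}" "i \<noteq> j" "\<sigma> \<in> spin_space N"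
    hence "N \<ge> 2" by auto
    thus "\<bar>heat_bath_rate (gibbs N J) i \<sigma> - heat_bath_rate (gibbs N J) i (flip_site j \<sigma>)\<bar> \<le> ?c i j"
      by (intro gibbs_influence[OF J] ij)
  next
    fix i assume "i \<in> {1..N}"
    have one: "(\<Sum>j\<in>{1..N}-{i}. if j = k then 1 else 0) \<le> (1 :: real)" for k
      by (simp add: sum.delta)
    have "(\<Sum>j\<in>{1..N}-{i}. ?c i j) = ?t / 2 * ((\<Sum>j\<in>{1..N}-{i}. if j = cyc_succ N i then 1 else 0)
        + (\<Sum>j\<in>{1..N}-{i}. if j = cyc_pred N i then 1 else 0))"
      by (simp only: sum_distrib_left[symmetric] sum.distrib)
    also have "\<dots> \<le> ?t / 2 * (1 + 1)" using t by (intro mult_left_mono add_mono one) auto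
    finally show "(\<Sum>j\<in>{1..N}-{i}. ?c i j) \<le> ?t" by simp
  qed
  moreover have "1 - ?t = 2 / (exp (4 * J) + 1)"
  proof -
    have "exp (4 * J) + 1 \<noteq> 0" using exp_gt_zero[of "4 * J"] by linarith
    thus ?thesis by (simp add: tanh_double_eq diff_divide_eq_iff)
  qed
  ultimately show ?thesis by simp
qed

section \<open>The Wolff dynamics\<close>

lemma aligned_edges_subset: "aligned_edges N \<sigma> \<subseteq> {1..N}"
  by (auto simp: aligned_edges_def)

lemma finite_aligned_edges [simp]: "finite (aligned_edges N \<sigma>)"
  by (rule finite_subset[OF aligned_edges_subset]) simp

lemma open_cluster_subset:
  assumes "E \<subseteq> {1..N}" "i \<in> {1..N}"
  shows "open_cluster N E i \<subseteq> {1..N}"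
proof
  fix j assume "j \<in> open_cluster N E i"
  hence "(i, j) \<in> ((\<lambda>e. (e, cyc_succ N e)) ` E \<union> (\<lambda>e. (cyc_succ N e, e)) ` E)\<^sup>*"
    by (simp add: open_cluster_def)
  thus "j \<in> {1..N}"
  proof induction
    case base show ?case by (rule assms(2))
  next
    case (step j k)
    then obtain e where "e \<in> E" "k = e \<or> k = cyc_succ N e" by auto
    thus ?case using assms(1) cyc_succ_in[of e N] by auto
  qed
qed

lemma open_edge_cluster_iff:
  assumes "e \<in> E"
  shows "e \<in> open_cluster N E i \<longleftrightarrow> cyc_succ N e \<in> open_cluster N E i"
proof -
  let ?R = "(\<lambda>e. (e, cyc_succ N e)) ` E \<union> (\<lambda>e. (cyc_succ N e, e)) ` E"
  have "(e, cyc_succ N e) \<in> ?R" "(cyc_succ N e, e) \<in> ?R" using assms by auto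
  thus ?thesis unfolding open_cluster_def mem_Collect_eq
    by (blast intro: rtrancl.rtrancl_into_rtrancl)
qed

lemma open_cluster_singleton:
  assumes "\<And>e. e \<in> E \<Longrightarrow> e \<noteq> i \<and> cyc_succ N e \<noteq> i"
  shows "open_cluster N E i = {i}"
proof -
  let ?R = "(\<lambda>e. (e, cyc_succ N e)) ` E \<union> (\<lambda>e. (cyc_succ N e, e)) ` E"
  have "j = i" if "(i, j) \<in> ?R\<^sup>*" for j
    using that
  proof (cases rule: converse_rtranclE)
    case (step k)
    thus ?thesis using assms by auto
  qed simp
  thus ?thesis by (auto simp: open_cluster_def)
qed

lemma aligned_after_cluster_flip:
  assumes "E \<subseteq> aligned_edges N \<sigma>"
  shows "E \<subseteq> aligned_edges N (flip_spins (open_cluster N E i) \<sigma>)"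
proof
  fix e assume e: "e \<in> E"
  thus "e \<in> aligned_edges N (flip_spins (open_cluster N E i) \<sigma>)"
    using assms open_edge_cluster_iff[OF e, of N i] by (auto simp: aligned_edges_def flip_spins_def)
qed

text \<open>
  The probability that \<open>E\<close> is the set of open edges, if \<open>A\<close> is the set of aligned edges.
\<close>

definition percolation_weight :: "real \<Rightarrow> nat set \<Rightarrow> nat set \<Rightarrow> real" where
  "percolation_weight J A E = (1 - exp (- 2 * J)) ^ card E * exp (- 2 * J) ^ card (A - E)"

lemma percolation_weight_nonneg: "J \<ge> 0 \<Longrightarrow> percolation_weight J A E \<ge> 0"
  by (simp add: percolation_weight_def)

lemma sum_percolation_weight:
  assumes "finite A"
  shows "(\<Sum>E\<in>Pow A. percolation_weight J A E) = 1"
  using prod_add[OF assms, of "\<lambda>_. 1 - exp (- 2 * J)" "\<lambda>_. exp (- 2 * J)"]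
  by (simp add: percolation_weight_def)

text \<open>
  The kernel as a finite sum over the starting site and the set of open edges. A function
  \<open>b\<close> in the support of the product measure is identified with the set of edges where it is
  true, which is a set of aligned edges.
\<close>

lemma wolff_kernel_eq:
  assumes N: "N \<ge> 1" and J: "J \<ge> 0"
  shows "wolff_kernel N J \<sigma> \<eta> = (\<Sum>i=1..N. \<Sum>E\<in>Pow (aligned_edges N \<sigma>).
     if flip_spins (open_cluster N E i) \<sigma> = \<eta> then percolation_weight J (aligned_edges N \<sigma>) E else 0) / real N"
proof -
  let ?A = "aligned_edges N \<sigma>" and ?p = "1 - exp (- 2 * J)"
  let ?Q = "Pi_pmf ?A False (\<lambda>_. bernoulli_pmf ?p)"
  have p: "0 \<le> ?p" "?p \<le> 1" using J by auto
  have inj: "inj_on (\<lambda>E e. e \<in> E) (Pow ?A)"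
    by (intro inj_onI) (auto simp: fun_eq_iff)
  have pmfQ: "pmf ?Q (\<lambda>e. e \<in> E) = percolation_weight J ?A E" if E: "E \<in> Pow ?A" for E
  proof -
    have "pmf ?Q (\<lambda>e. e \<in> E) = (\<Prod>e\<in>?A. pmf (bernoulli_pmf ?p) (e \<in> E))"
      using E by (intro pmf_Pi') auto
    also have "\<dots> = (\<Prod>e\<in>?A - E. pmf (bernoulli_pmf ?p) (e \<in> E)) * (\<Prod>e\<in>E. pmf (bernoulli_pmf ?p) (e \<in> E))"
      using E by (intro prod.subset_diff) auto
    also have "(\<Prod>e\<in>?A - E. pmf (bernoulli_pmf ?p) (e \<in> E)) = exp (- 2 * J) ^ card (?A - E)"
      using p by simp
    also have "(\<Prod>e\<in>E. pmf (bernoulli_pmf ?p) (e \<in> E)) = ?p ^ card E"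
      using p by simp
    finally show ?thesis by (simp add: percolation_weight_def)
  qed
  have inner: "pmf (bind_pmf ?Q (\<lambda>b. return_pmf (flip_spins (open_cluster N {e. b e} i) \<sigma>))) \<eta>
      = (\<Sum>E\<in>Pow ?A. if flip_spins (open_cluster N E i) \<sigma> = \<eta> then percolation_weight J ?A E else 0)" for i
  proof -
    have "pmf (bind_pmf ?Q (\<lambda>b. return_pmf (flip_spins (open_cluster N {e. b e} i) \<sigma>))) \<eta>
        = (\<Sum>b\<in>(\<lambda>E e. e \<in> E) ` Pow ?A.
            pmf (return_pmf (flip_spins (open_cluster N {e. b e} i) \<sigma>)) \<eta> * pmf ?Q b)"
      unfolding pmf_bind
    proof (rule integral_measure_pmf_real)
      fix b assume "b \<in> set_pmf ?Q"
      hence "{e. b e} \<in> Pow ?A" using set_Pi_pmf_subset[of ?A False "\<lambda>_. bernoulli_pmf ?p"] by auto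
      thus "b \<in> (\<lambda>E e. e \<in> E) ` Pow ?A" by (intro image_eqI[of _ _ "{e. b e}"]) auto
    qed simp
    also have "\<dots> = (\<Sum>E\<in>Pow ?A. pmf (return_pmf (flip_spins (open_cluster N E i) \<sigma>)) \<eta> * pmf ?Q (\<lambda>e. e \<in> E))"
      by (subst sum.reindex[OF inj]) simp
    also have "\<dots> = (\<Sum>E\<in>Pow ?A. if flip_spins (open_cluster N E i) \<sigma> = \<eta> then percolation_weight J ?A E else 0)"
      by (intro sum.cong refl) (simp only: pmfQ, simp add: indicator_def)
    finally show ?thesis .
  qed
  show ?thesis unfolding wolff_kernel_def wolff_step_def
    using N by (subst pmf_bind_pmf_of_set) (simp_all only: inner, auto)
qed

lemma wolff_kernel_sum:
  assumes N: "N \<ge> 1" and \<sigma>: "\<sigma> \<in> spin_space N"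
  shows "(\<Sum>\<eta>\<in>spin_space N. wolff_kernel N J \<sigma> \<eta>) = 1"
proof -
  have "set_pmf (wolff_step N J \<sigma>) \<subseteq> spin_space N"
  proof -
    have "flip_spins (open_cluster N {e. b e} i) \<sigma> \<in> spin_space N"
      if "i \<in> {1..N}" "b \<in> set_pmf (Pi_pmf (aligned_edges N \<sigma>) False (\<lambda>_. bernoulli_pmf p))" for i b p
    proof -
      have "{e. b e} \<subseteq> aligned_edges N \<sigma>"
        using that(2) set_Pi_pmf_subset[of "aligned_edges N \<sigma>" False "\<lambda>_. bernoulli_pmf p"] by auto
      hence "{e. b e} \<subseteq> {1..N}" using aligned_edges_subset by blast
      thus ?thesis by (intro flip_spins_in_spin_space[OF \<sigma>] open_cluster_subset that(1))
    qed
    thus ?thesis using N unfolding wolff_step_def by (auto simp: set_bind_pmf)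
  qed
  thus ?thesis unfolding wolff_kernel_def by (intro sum_pmf_eq_1) auto
qed

lemma gibbs_weight_aligned:
  assumes \<sigma>: "\<sigma> \<in> spin_space N"
  shows "gibbs_weight N J \<sigma> = exp (J * (2 * real (card (aligned_edges N \<sigma>)) - real N))"
proof -
  let ?A = "aligned_edges N \<sigma>"
  have "(\<Sum>e=1..N. real_of_int (\<sigma> e * \<sigma> (cyc_succ N e))) = (\<Sum>e=1..N. 2 * (if e \<in> ?A then 1 else 0) - 1)"
  proof (rule sum.cong[OF refl])
    fix e assume e: "e \<in> {1..N}"
    show "real_of_int (\<sigma> e * \<sigma> (cyc_succ N e)) = 2 * (if e \<in> ?A then 1 else 0) - 1"
      using e spin_values[OF \<sigma> e] spin_values[OF \<sigma> cyc_succ_in[OF e]]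
      by (auto simp: aligned_edges_def)
  qed
  also have "\<dots> = 2 * (\<Sum>e=1..N. if e \<in> ?A then 1 else 0) - real N"
    by (simp add: sum_subtractf sum_distrib_left)
  also have "(\<Sum>e=1..N. if e \<in> ?A then 1 else 0) = real (card ?A)"
    using aligned_edges_subset[of N \<sigma>] by (simp add: sum.If_cases Int_absorb1)
  finally show ?thesis unfolding gibbs_weight_def by simp
qed

text \<open>
  The Edwards--Sokal coupling: the joint weight of a spin configuration and a set of open edges
  depends on the spins only through the condition that all open edges are aligned. An aligned
  edge that is closed contributes \<open>exp J * exp (- 2 * J) = exp (- J)\<close>, which is the contribution of a
  misaligned edge.
\<close>

lemma edwards_sokal_weight:
  assumes \<sigma>: "\<sigma> \<in> spin_space N" and E: "E \<subseteq> aligned_edges N \<sigma>"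
  shows "gibbs_weight N J \<sigma> * percolation_weight J (aligned_edges N \<sigma>) E
    = exp (- J * real N) * (1 - exp (- 2 * J)) ^ card E * exp (2 * J) ^ card E"
proof -
  let ?A = "aligned_edges N \<sigma>"
  have card: "real (card ?A) = real (card E) + real (card (?A - E))"
    using card_Diff_subset[OF finite_subset[OF E] E] card_mono[OF _ E] by simp
  have "gibbs_weight N J \<sigma> * exp (- 2 * J) ^ card (?A - E)
      = exp (J * (2 * real (card ?A) - real N) + real (card (?A - E)) * (- 2 * J))"
    unfolding gibbs_weight_aligned[OF \<sigma>] exp_of_nat_mult[symmetric] exp_add ..
  also have "\<dots> = exp (- J * real N + real (card E) * (2 * J))"
    unfolding card by (simp add: algebra_simps)
  also have "\<dots> = exp (- J * real N) * exp (2 * J) ^ card E"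
    unfolding exp_add exp_of_nat_mult ..
  finally show ?thesis unfolding percolation_weight_def by (simp add: mult_ac)
qed

text \<open>
  For a fixed starting site and a fixed set of open edges a step is an involution: flipping a whole
  open cluster keeps all open edges aligned and hence keeps the joint weight.
\<close>

lemma wolff_detailed_balance:
  assumes N: "N \<ge> 1" and J: "J \<ge> 0" and \<sigma>: "\<sigma> \<in> spin_space N" and \<eta>: "\<eta> \<in> spin_space N"
  shows "gibbs N J \<sigma> * wolff_kernel N J \<sigma> \<eta> = gibbs N J \<eta> * wolff_kernel N J \<eta> \<sigma>"
proof -
  let ?w = "\<lambda>E. exp (- J * real N) * (1 - exp (- 2 * J)) ^ card E * exp (2 * J) ^ card E"
  let ?c = "\<lambda>\<sigma> \<eta> i E. E \<subseteq> aligned_edges N \<sigma> \<and> flip_spins (open_cluster N E i) \<sigma> = \<eta>"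
  have joint: "gibbs_weight N J \<sigma> * wolff_kernel N J \<sigma> \<eta>
      = (\<Sum>i=1..N. \<Sum>E\<in>Pow {1..N}. if ?c \<sigma> \<eta> i E then ?w E else 0) / real N"
    if \<sigma>: "\<sigma> \<in> spin_space N" for \<sigma> \<eta>
  proof -
    have "gibbs_weight N J \<sigma> * (\<Sum>E\<in>Pow (aligned_edges N \<sigma>).
          if flip_spins (open_cluster N E i) \<sigma> = \<eta> then percolation_weight J (aligned_edges N \<sigma>) E else 0)
        = (\<Sum>E\<in>Pow {1..N}. if ?c \<sigma> \<eta> i E then ?w E else 0)" for i
      unfolding sum_distrib_left
      by (rule sum.mono_neutral_cong_left)
         (use aligned_edges_subset[of N \<sigma>] in \<open>auto simp: edwards_sokal_weight[OF \<sigma>]\<close>)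
    thus ?thesis unfolding wolff_kernel_eq[OF N J] times_divide_eq_right sum_distrib_left[of _ _ "{1..N}"]
      by simp
  qed
  have sym: "?c \<sigma> \<eta> i E" if "?c \<eta> \<sigma> i E" for \<sigma> \<eta> i E
    using that aligned_after_cluster_flip[of E N \<eta> i] by auto
  have "gibbs_weight N J \<sigma> * wolff_kernel N J \<sigma> \<eta> = gibbs_weight N J \<eta> * wolff_kernel N J \<eta> \<sigma>"
  proof -
    have "?c \<sigma> \<eta> i E \<longleftrightarrow> ?c \<eta> \<sigma> i E" for i E using sym by blast
    thus ?thesis unfolding joint[OF \<sigma>] joint[OF \<eta>] by simp
  qed
  thus ?thesis by (simp add: gibbs_def)
qed

lemma wolff_reversible_chain:
  assumes N: "N \<ge> 1" and J: "J \<ge> 0"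
  shows "reversible_chain (spin_space N) (gibbs N J) (wolff_kernel N J)"
proof
  fix \<sigma> \<eta> assume "\<sigma> \<in> spin_space N" "\<eta> \<in> spin_space N"
  thus "gibbs N J \<sigma> * wolff_kernel N J \<sigma> \<eta> = gibbs N J \<eta> * wolff_kernel N J \<eta> \<sigma>"
    by (rule wolff_detailed_balance[OF N J])
qed (simp_all add: gibbs_pos gibbs_sum wolff_kernel_sum[OF N], simp add: wolff_kernel_def)

text \<open>
  If the step starts at \<open>i\<close> and the aligned edges at \<open>i\<close> are closed, the cluster is \<open>{i}\<close>. The
  states of the remaining aligned edges are summed out.
\<close>

lemma wolff_single_site_flip_ge:
  assumes N: "N \<ge> 1" and J: "J \<ge> 0" and i: "i \<in> {1..N}"
  shows "wolff_kernel N J \<sigma> (flip_site i \<sigma>)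
    \<ge> exp (- 2 * J) ^ card (aligned_edges N \<sigma> \<inter> {i, cyc_pred N i}) / real N"
proof -
  let ?A = "aligned_edges N \<sigma>"
  let ?B = "?A - {i, cyc_pred N i}"
  let ?t = "\<lambda>i' E. if flip_spins (open_cluster N E i') \<sigma> = flip_site i \<sigma> then percolation_weight J ?A E else 0"
  have single: "open_cluster N E i = {i}" if E: "E \<in> Pow ?B" for E
  proof (rule open_cluster_singleton)
    fix e assume "e \<in> E"
    hence "e \<in> {1..N}" "e \<noteq> i" "e \<noteq> cyc_pred N i" using E aligned_edges_subset[of N \<sigma>] by auto
    thus "e \<noteq> i \<and> cyc_succ N e \<noteq> i" using cyc_pred_succ[of e N] by auto
  qed
  have weight: "percolation_weight J ?A E
      = exp (- 2 * J) ^ card (?A \<inter> {i, cyc_pred N i}) * percolation_weight J ?B E" if E: "E \<in> Pow ?B" for E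
  proof -
    have "?A - E = (?A \<inter> {i, cyc_pred N i}) \<union> (?B - E)" using E by auto
    hence "card (?A - E) = card (?A \<inter> {i, cyc_pred N i}) + card (?B - E)"
      by (simp only:) (intro card_Un_disjoint, auto)
    thus ?thesis by (simp add: percolation_weight_def power_add)
  qed
  have "exp (- 2 * J) ^ card (?A \<inter> {i, cyc_pred N i})
      = exp (- 2 * J) ^ card (?A \<inter> {i, cyc_pred N i}) * (\<Sum>E\<in>Pow ?B. percolation_weight J ?B E)"
    by (subst sum_percolation_weight) simp_all
  also have "\<dots> = (\<Sum>E\<in>Pow ?B. ?t i E)"
    unfolding sum_distrib_left by (intro sum.cong refl) (simp add: single weight)
  also have "\<dots> \<le> (\<Sum>E\<in>Pow ?A. ?t i E)"
    by (intro sum_mono2) (auto simp: percolation_weight_nonneg[OF J])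
  also have "\<dots> \<le> (\<Sum>i'=1..N. \<Sum>E\<in>Pow ?A. ?t i' E)"
    using i by (intro member_le_sum[of i "{1..N}" "\<lambda>i'. \<Sum>E\<in>Pow ?A. ?t i' E"] sum_nonneg)
      (auto simp: percolation_weight_nonneg[OF J])
  finally show ?thesis unfolding wolff_kernel_eq[OF N J] by (intro divide_right_mono) auto
qed

text \<open>
  With \<open>a\<close> aligned edges at \<open>i\<close> and \<open>y = exp (2 * J * (a - 1))\<close>, the two sides times \<open>N\<close> are
  \<open>exp (- 2 * J)\<close> times \<open>2 / (1 + y\<^sup>2)\<close> and at least \<open>exp (- 2 * J)\<close> times \<open>1 / y\<close>. So the
  inequality is \<open>2 * y \<le> 1 + y\<^sup>2\<close>. The loop of the cycle with one site is treated separately.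
\<close>

lemma wolff_rate_ge_heat_bath_rate:
  assumes N: "N \<ge> 1" and J: "J \<ge> 0" and i: "i \<in> {1..N}" and \<sigma>: "\<sigma> \<in> spin_space N"
  shows "2 * exp (- 2 * J) / real N * heat_bath_rate (gibbs N J) i \<sigma> \<le> wolff_kernel N J \<sigma> (flip_site i \<sigma>)"
proof -
  let ?a = "card (aligned_edges N \<sigma> \<inter> {i, cyc_pred N i})"
  have "2 * exp (- 2 * J) * heat_bath_rate (gibbs N J) i \<sigma> \<le> exp (- 2 * J) ^ ?a"
  proof (cases "N = 1")
    case True
    hence i1: "i = 1" using i by simp
    have "heat_bath_rate (gibbs N J) i \<sigma> = 1 / 2"
    proof -
      have "gibbs N J (flip_site i \<sigma>) = gibbs N J \<sigma>"
        using True i1 by (simp add: gibbs_def gibbs_weight_def cyc_succ_def flip_spins_def)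
      thus ?thesis using gibbs_pos[of N J \<sigma>] by (simp add: heat_bath_rate_def)
    qed
    moreover have "?a = 1"
      using True i1 by (simp add: aligned_edges_def cyc_pred_def cyc_succ_def Int_insert_left)
    ultimately show ?thesis by simp
  next
    case False
    hence N2: "N \<ge> 2" using N by simp
    let ?p = "cyc_pred N i"
    have p: "?p \<in> {1..N}" "?p \<noteq> i" by (rule cyc_pred_in[OF i], rule cyc_pred_neq[OF N2 i])
    have a: "real ?a = (if \<sigma> i = \<sigma> (cyc_succ N i) then 1 else 0) + (if \<sigma> ?p = \<sigma> i then 1 else 0)"
      using i p cyc_succ_pred[OF i] by (simp add: aligned_edges_def Int_insert_right)
    have x: "local_alignment N \<sigma> i = 2 * (real ?a - 1)"
      unfolding a local_alignment_def
      using spin_values[OF \<sigma> i] spin_values[OF \<sigma> p(1)] spin_values[OF \<sigma> cyc_succ_in[OF i]] by auto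
    define y where "y = exp (2 * J * (real ?a - 1))"
    have y: "y > 0" by (simp add: y_def)
    have "exp (2 * J * local_alignment N \<sigma> i) = y\<^sup>2"
      unfolding y_def x exp_double[symmetric] by (simp add: algebra_simps)
    hence r: "heat_bath_rate (gibbs N J) i \<sigma> = 1 / (1 + y\<^sup>2)"
      by (simp add: heat_bath_rate_gibbs[OF N2 i])
    have pw: "exp (- 2 * J) ^ ?a = exp (- 2 * J) * (1 / y)"
    proof -
      have "exp (- 2 * J) ^ ?a = exp (real ?a * (- 2 * J))" by (rule exp_of_nat_mult[symmetric])
      also have "\<dots> = exp (- 2 * J + - (2 * J * (real ?a - 1)))" by (simp add: algebra_simps)
      also have "\<dots> = exp (- 2 * J) * (1 / y)" unfolding exp_add y_def by (simp add: exp_minus inverse_eq_divide)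
      finally show ?thesis .
    qed
    have "2 * y \<le> 1 + y\<^sup>2" using zero_le_power2[of "y - 1"] by (simp add: power2_diff)
    hence "2 * (1 / (1 + y\<^sup>2)) \<le> 1 / y" using y by (simp add: divide_simps add_pos_pos)
    hence "exp (- 2 * J) * (2 * (1 / (1 + y\<^sup>2))) \<le> exp (- 2 * J) * (1 / y)"
      by (intro mult_left_mono) simp_all
    thus ?thesis unfolding r pw by (simp add: mult.commute)
  qed
  hence "2 * exp (- 2 * J) * heat_bath_rate (gibbs N J) i \<sigma> / real N \<le> exp (- 2 * J) ^ ?a / real N"
    by (intro divide_right_mono) simp_all
  also have "\<dots> \<le> wolff_kernel N J \<sigma> (flip_site i \<sigma>)" by (rule wolff_single_site_flip_ge[OF N J i])
  finally show ?thesis by simp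
qed

text \<open>
  Discard all Wolff moves other than single-site flips and compare the remaining ones with the heat
  bath.
\<close>

lemma wolff_spectral_gap:
  assumes N: "N \<ge> 1" and J: "J \<ge> 0"
    and g: "g \<in> weighted_space.mean_zero (spin_space N) (gibbs N J)"
  shows "wip (spin_space N) (gibbs N J) g g
    \<le> real N * exp (2 * J) * (exp (4 * J) + 1) / 4 *
        reversible_chain.dirichlet (spin_space N) (gibbs N J) (wolff_kernel N J) g"
proof -
  interpret reversible_chain "spin_space N" "gibbs N J" "wolff_kernel N J"
    by (rule wolff_reversible_chain[OF N J])
  let ?O = "spin_space N" and ?\<mu> = "gibbs N J"
  have "2 * exp (- 2 * J) / real N * heat_bath_form N ?\<mu> g
      = (\<Sum>\<sigma>\<in>?O. \<Sum>i=1..N. ?\<mu> \<sigma> * (2 * exp (- 2 * J) / real N * heat_bath_rate ?\<mu> i \<sigma>) * (g \<sigma> - g (flip_site i \<sigma>))\<^sup>2) / 2"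
    unfolding heat_bath_form_def times_divide_eq_right sum_distrib_left by (simp add: mult_ac)
  also have "\<dots> \<le> (\<Sum>\<sigma>\<in>?O. \<Sum>\<eta>\<in>?O. ?\<mu> \<sigma> * wolff_kernel N J \<sigma> \<eta> * (g \<sigma> - g \<eta>)\<^sup>2) / 2"
  proof (intro divide_right_mono sum_mono)
    fix \<sigma> assume \<sigma>: "\<sigma> \<in> ?O"
    have "(\<Sum>i=1..N. ?\<mu> \<sigma> * (2 * exp (- 2 * J) / real N * heat_bath_rate ?\<mu> i \<sigma>) * (g \<sigma> - g (flip_site i \<sigma>))\<^sup>2)
        \<le> (\<Sum>i=1..N. ?\<mu> \<sigma> * wolff_kernel N J \<sigma> (flip_site i \<sigma>) * (g \<sigma> - g (flip_site i \<sigma>))\<^sup>2)"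
      by (intro sum_mono mult_right_mono mult_left_mono wolff_rate_ge_heat_bath_rate N J \<sigma>)
         (simp_all add: gibbs_pos less_imp_le)
    also have "\<dots> = (\<Sum>\<eta>\<in>(\<lambda>i. flip_site i \<sigma>) ` {1..N}. ?\<mu> \<sigma> * wolff_kernel N J \<sigma> \<eta> * (g \<sigma> - g \<eta>)\<^sup>2)"
    proof (subst sum.reindex)
      show "inj_on (\<lambda>i. flip_site i \<sigma>) {1..N}"
      proof (rule inj_onI)
        fix i j assume ij: "i \<in> {1..N}" "j \<in> {1..N}" "flip_site i \<sigma> = flip_site j \<sigma>"
        hence "flip_site i \<sigma> i = flip_site j \<sigma> i" by simp
        thus "i = j" using spin_values[OF \<sigma> ij(1)] by (auto simp: flip_spins_def split: if_splits)
      qed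
    qed simp
    also have "\<dots> \<le> (\<Sum>\<eta>\<in>?O. ?\<mu> \<sigma> * wolff_kernel N J \<sigma> \<eta> * (g \<sigma> - g \<eta>)\<^sup>2)"
    proof (intro sum_mono2)
      show "(\<lambda>i. flip_site i \<sigma>) ` {1..N} \<subseteq> ?O" using flip_spins_in_spin_space[OF \<sigma>] by auto
      fix \<eta> assume "\<eta> \<in> ?O - (\<lambda>i. flip_site i \<sigma>) ` {1..N}"
      thus "0 \<le> ?\<mu> \<sigma> * wolff_kernel N J \<sigma> \<eta> * (g \<sigma> - g \<eta>)\<^sup>2"
        by (simp add: gibbs_pos less_imp_le wolff_kernel_def)
    qed simp
    finally show "(\<Sum>i=1..N. ?\<mu> \<sigma> * (2 * exp (- 2 * J) / real N * heat_bath_rate ?\<mu> i \<sigma>) * (g \<sigma> - g (flip_site i \<sigma>))\<^sup>2)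
        \<le> (\<Sum>\<eta>\<in>?O. ?\<mu> \<sigma> * wolff_kernel N J \<sigma> \<eta> * (g \<sigma> - g \<eta>)\<^sup>2)" .
  qed simp
  finally have compare: "2 * exp (- 2 * J) / real N * heat_bath_form N ?\<mu> g \<le> dirichlet g"
    unfolding dirichlet_def .
  let ?C = "real N * exp (2 * J) * (exp (4 * J) + 1) / 4"
  have e1: "exp (4 * J) + 1 > 0" by (simp add: add_pos_pos)
  have "?C * (2 * exp (- 2 * J) / real N * (2 / (exp (4 * J) + 1))) = 1"
  proof -
    have "n * a * e / 4 * (2 * inverse a / n * (2 / e)) = 1" if "n \<noteq> 0" "a \<noteq> 0" "e \<noteq> 0" for n a e :: real
      using that by (simp add: field_simps)
    from this[of "real N" "exp (2 * J)" "exp (4 * J) + 1"] show ?thesis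
      using N e1 by (simp add: exp_minus)
  qed
  hence "ip g g = ?C * (2 * exp (- 2 * J) / real N * (2 / (exp (4 * J) + 1) * ip g g))"
    by (simp only: mult.assoc[symmetric])
  also have "\<dots> \<le> ?C * (2 * exp (- 2 * J) / real N * heat_bath_form N ?\<mu> g)"
    using e1 by (intro mult_left_mono heat_bath_ising_gap[OF J g]) simp_all
  also have "\<dots> \<le> ?C * dirichlet g" using e1 by (intro mult_left_mono compare) simp_all
  finally show ?thesis .
qed

section \<open>Convergence of ergodic averages\<close>

text \<open>
  The spectral gap gives the factors \<open>1 + C\<close> and \<open>2 * C = exp (2 * J) * (exp (4 * J) + 1) * (1 / 2) * N\<close>.
  The stated constants arise when a nonnegative multiple of \<open>J\<close> is added to the factor \<open>1 / 2\<close>,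
  which can only increase the bounds.
\<close>

theorem theorem3p11:
  fixes N M :: nat and J :: real and f :: "(nat \<Rightarrow> int) \<Rightarrow> real"
  assumes "N \<ge> 1" and "M \<ge> 1" and "J \<ge> 0"
  shows
    "(gibbs_L2_norm N J
       (\<lambda>x. 1 / real M * (\<Sum>k=1..M. kernel_apply (spin_space N) (wolff_kernel N J) k f x)
            - gibbs_expectation N J f)
     \<le> gibbs_L2_norm N J f / real M *
       (2 + exp (2 * J) * (exp (4 * J) + 1) / 2 *
            (1 / 2 + J * exp ((exp (2 * J) - 1) / 2)) * real N)) \<and>
     (\<forall>(S :: 'w measure) Y.
       markov_chain S Y (spin_space N) (gibbs N J) (wolff_kernel N J) \<longrightarrow>
       (\<integral>w. (1 / real M * (\<Sum>k=1..M. f (Y k w)) - gibbs_expectation N J f)\<^sup>2 \<partial>S)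
       \<le> (gibbs_L2_norm N J f)\<^sup>2 / real M *
         (exp (2 * J) * (exp (4 * J) + 1) *
          (1 / 2 + J * exp ((exp (2 * J) - 1) / 2)) * real N))"
proof -
  interpret reversible_chain "spin_space N" "gibbs N J" "wolff_kernel N J"
    by (rule wolff_reversible_chain[OF assms(1,3)])
  define C where "C = real N * exp (2 * J) * (exp (4 * J) + 1) / 4"
  define K where "K = exp (2 * J) * (exp (4 * J) + 1) * (1 / 2 + J * exp ((exp (2 * J) - 1) / 2)) * real N"
  have gap: "ip g g \<le> C * dirichlet g" if "g \<in> mean_zero" for g
    unfolding C_def by (rule wolff_spectral_gap[OF assms(1,3) that])
  have "1 * 1 * (1 + 1) \<le> real N * exp (2 * J) * (exp (4 * J) + 1)"
    using assms by (intro mult_mono add_mono) auto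
  hence C: "C \<ge> 1 / 2" by (simp add: C_def)
  have CK: "2 * C \<le> K"
  proof -
    let ?u = "exp (2 * J) * (exp (4 * J) + 1)"
    have "2 * C = ?u * (1 / 2) * real N" by (simp add: C_def)
    also have "\<dots> \<le> ?u * (1 / 2 + J * exp ((exp (2 * J) - 1) / 2)) * real N"
      using assms by (intro mult_right_mono mult_left_mono) auto
    finally show ?thesis unfolding K_def .
  qed
  have sq: "(gibbs_L2_norm N J f)\<^sup>2 = (\<Sum>\<sigma>\<in>spin_space N. (f \<sigma>)\<^sup>2 * gibbs N J \<sigma>)"
    unfolding gibbs_L2_norm_def gibbs_expectation_def
    by (intro real_sqrt_pow2 sum_nonneg) (simp add: gibbs_pos less_imp_le)
  have norm_nonneg: "gibbs_L2_norm N J f \<ge> 0"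
    unfolding gibbs_L2_norm_def gibbs_expectation_def
    by (intro real_sqrt_ge_zero sum_nonneg) (simp add: gibbs_pos less_imp_le)
  have "gibbs_L2_norm N J
       (\<lambda>x. 1 / real M * (\<Sum>k=1..M. kernel_apply (spin_space N) (wolff_kernel N J) k f x)
            - gibbs_expectation N J f)
      \<le> sqrt (((1 + C) / real M)\<^sup>2 * (gibbs_L2_norm N J f)\<^sup>2)"
    unfolding sq unfolding gibbs_L2_norm_def gibbs_expectation_def
    using C by (intro real_sqrt_le_mono ergodic_average_L2_le[OF gap _ assms(2)]) auto
  also have "\<dots> = gibbs_L2_norm N J f / real M * (1 + C)"
    using C norm_nonneg by (simp add: real_sqrt_mult)
  also have "\<dots> \<le> gibbs_L2_norm N J f / real M * (2 + K / 2)"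
    using CK C norm_nonneg by (intro mult_left_mono) auto
  finally have first: "gibbs_L2_norm N J
       (\<lambda>x. 1 / real M * (\<Sum>k=1..M. kernel_apply (spin_space N) (wolff_kernel N J) k f x)
            - gibbs_expectation N J f) \<le> gibbs_L2_norm N J f / real M * (2 + K / 2)" .
  have second: "(\<integral>w. (1 / real M * (\<Sum>k=1..M. f (Y k w)) - gibbs_expectation N J f)\<^sup>2 \<partial>S)
      \<le> (gibbs_L2_norm N J f)\<^sup>2 / real M * K"
    if mc: "markov_chain S Y (spin_space N) (gibbs N J) (wolff_kernel N J)" for S :: "'w measure" and Y
  proof -
    have "(\<integral>w. (1 / real M * (\<Sum>k=1..M. f (Y k w)) - gibbs_expectation N J f)\<^sup>2 \<partial>S)
        \<le> 2 * C / real M * (gibbs_L2_norm N J f)\<^sup>2"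
      unfolding sq unfolding gibbs_expectation_def
      by (rule stationary_mean_square_error_le[OF gap C assms(2) mc])
    also have "\<dots> = (gibbs_L2_norm N J f)\<^sup>2 / real M * (2 * C)" by simp
    also have "\<dots> \<le> (gibbs_L2_norm N J f)\<^sup>2 / real M * K" by (intro mult_left_mono CK) simp
    finally show ?thesis .
  qed
  have half: "K / 2 = exp (2 * J) * (exp (4 * J) + 1) / 2 * (1 / 2 + J * exp ((exp (2 * J) - 1) / 2)) * real N"
    by (simp add: K_def)
  show ?thesis using first[unfolded half] second[unfolded K_def] by blast
qed

end
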